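(* For every $x\in\mathbb{R}^2$, the path loss fading process $Sh^x=\{s_i^x\}_{i\ge 0}$ is a Poisson point process on $\mathbb{R}^+$ with intensity density $d\Lambda(t)=\lambda_B B'(t)\,dt$. In addition, $B(0)=0$ and $B(\infty)=\infty$, where $B(0)=\lim_{\beta\to 0^+}B(\beta)$ and $B(\infty)=\lim_{\beta\to\infty}B(\beta)$.
   Context: Base stations: $\Pi_B=\{y_0,y_1,\dots\}$ is a homogeneous Poisson point process on $\mathbb{R}^2$ of intensity $\lambda_B>0$. Path loss: $L:\mathbb{R}^2\to(0,\infty)$ is a measurable function (values on a Lebesgue-null set are irrelevant). Fading: $H$ is a nonnegative random variable with probability density function $p_H$ and complementary cumulative distribution function $F_H(\beta)=P(H\ge\beta)=\int_\beta^\infty p_H(t)\,dt$, assumed to satisfy $F_H(\beta)>0$ for all $\beta$. For fixed $x\in\mathbb{R}^2$, the fading variables $h_{y_i x}$, $i\ge0$, are independent copies of $H$, independent of $\Pi_B$. Define $B(\beta)=\int_{\mathbb{R}^2}F_H\big((L(z)\beta)^{-1}\big)\,dz$ for $\beta>0$; it is assumed that $0<B(\beta)<\infty$ for all $\beta>0$. $B$ is nondecreasing, and $B'$ denotes its derivative (defined for almost every $\beta$). For $x\in\mathbb{R}^2$, the path loss fading process is $Sh^x=\{s_i^x\}_{i\ge0}$ with $s_i^x=\big(h_{y_i x}L(y_i-x)\big)^{-1}$. *)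

theory Defs
  imports "HOL-Probability.Probability"
begin

text \<open>A point process is given by an enumeration \<open>X\<^sub>0, X\<^sub>1, \<dots>\<close> of its points.  Its counting
  variable \<open>N(A)\<close> counts indices, i.e. points with multiplicity.\<close>

definition point_count :: "(nat \<Rightarrow> 'w \<Rightarrow> 'a) \<Rightarrow> 'a set \<Rightarrow> 'w \<Rightarrow> ennreal" where
  "point_count X A \<omega> = (\<Sum>i. indicator A (X i \<omega>))"

text \<open>Poisson point process on \<open>S\<close> with intensity measure \<open>\<Lambda>\<close>: \<open>N(A)\<close> is Poisson distributed with
  mean \<open>\<Lambda>(A)\<close> for all measurable \<open>A \<subseteq> S\<close>, and counts in disjoint sets are independent.
  If \<open>\<Lambda>(A)\<close> is infinite, then \<open>N(A)\<close> is almost surely infinite.  Only \<open>\<Lambda>\<close> restricted to \<open>S\<close>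
  matters; the points need to lie in \<open>S\<close> only almost surely.\<close>

definition poisson_point_process_on ::
    "'w measure \<Rightarrow> 'a set \<Rightarrow> 'a measure \<Rightarrow> (nat \<Rightarrow> 'w \<Rightarrow> 'a) \<Rightarrow> bool" where
  "poisson_point_process_on M S \<Lambda> X \<longleftrightarrow>
     S \<in> sets \<Lambda> \<and>
     (\<forall>i. X i \<in> measurable M \<Lambda>) \<and>
     (AE \<omega> in M. \<forall>i. X i \<omega> \<in> S) \<and>
     (\<forall>A \<in> sets \<Lambda>. A \<subseteq> S \<longrightarrow> (\<forall>k::nat.
        measure M {\<omega> \<in> space M. point_count X A \<omega> = of_nat k} =
          (if emeasure \<Lambda> A = \<infinity> then 0
           else exp (- measure \<Lambda> A) * measure \<Lambda> A ^ k / fact k))) \<and>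
     (\<forall>(n::nat) A. (\<forall>j<n. A j \<in> sets \<Lambda> \<and> A j \<subseteq> S) \<and> disjoint_family_on A {..<n} \<longrightarrow>
        prob_space.indep_vars M (\<lambda>_. borel) (\<lambda>j. point_count X (A j)) {..<n})"

text \<open>Independence of two random elements whose values may have different types, which the
  library's \<open>indep_var\<close> does not allow: the generated sigma-algebras are independent.\<close>

definition indep_rvs ::
    "'w measure \<Rightarrow> 'a measure \<Rightarrow> ('w \<Rightarrow> 'a) \<Rightarrow> 'b measure \<Rightarrow> ('w \<Rightarrow> 'b) \<Rightarrow> bool" where
  "indep_rvs M S X T Y \<longleftrightarrow>
     X \<in> measurable M S \<and> Y \<in> measurable M T \<and>
     prob_space.indep_set M (sets (vimage_algebra (space M) X S)) (sets (vimage_algebra (space M) Y T))"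

definition ccdf :: "'w measure \<Rightarrow> ('w \<Rightarrow> real) \<Rightarrow> real \<Rightarrow> real" where
  "ccdf M H \<beta> = measure M {\<omega> \<in> space M. \<beta> \<le> H \<omega>}"

definition B_integrand ::
    "'w measure \<Rightarrow> ('w \<Rightarrow> real) \<Rightarrow> (real^2 \<Rightarrow> real) \<Rightarrow> real \<Rightarrow> real^2 \<Rightarrow> real" where
  "B_integrand M H L \<beta> z = ccdf M H (inverse (L z * \<beta>))"

text \<open>Meaningful for \<open>\<beta> > 0\<close> and an integrable integrand; finiteness of this integral of a
  nonnegative function has to be expressed by \<open>integrable\<close>.\<close>

definition B_fun :: "'w measure \<Rightarrow> ('w \<Rightarrow> real) \<Rightarrow> (real^2 \<Rightarrow> real) \<Rightarrow> real \<Rightarrow> real" where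
  "B_fun M H L \<beta> = (LINT z|lborel. B_integrand M H L \<beta> z)"

text \<open>\<open>h i x\<close> is the fading variable between the \<open>i\<close>-th base station \<open>y i\<close> and the location \<open>x\<close>.\<close>

definition path_loss_fading ::
    "(real^2 \<Rightarrow> real) \<Rightarrow> (nat \<Rightarrow> 'w \<Rightarrow> real^2) \<Rightarrow> (nat \<Rightarrow> real^2 \<Rightarrow> 'w \<Rightarrow> real) \<Rightarrow>
     real^2 \<Rightarrow> nat \<Rightarrow> 'w \<Rightarrow> real" where
  "path_loss_fading L y h x i \<omega> = inverse (h i x \<omega> * L (y i \<omega> - x))"

end

theory Submission imports Defs begin

text \<open>
  The pairs \<open>(y\<^sub>i, h\<^sub>i)\<close> form a Poisson process on the product of the plane and the half-line, because
  the fading variables are independent marks; the map \<open>(z, t) \<mapsto> 1 / (t L(z - x))\<close> sends it to the path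
  loss fading process, which is therefore Poisson with the image measure as intensity.  By translation
  invariance this image does not depend on \<open>x\<close>: it is \<open>\<lambda>\<^sub>B \<nu>\<close>, where \<open>\<nu>\<close> assigns to \<open>(0, \<beta>]\<close> the integral
  of \<open>P(H \<ge> 1 / (L(z) \<beta>))\<close> over the plane and no mass to \<open>(-\<infinity>, 0]\<close>.  So \<open>B\<close> is the distribution function of \<open>\<nu>\<close>.

  The marking and mapping step (\<open>poisson_marking_mapping\<close>) is proved with probability generating
  functionals.  A process with intensity \<open>\<Lambda>\<close> is Poisson exactly when \<open>E \<Prod>\<^sub>i f(X\<^sub>i) = exp(-\<integral>(1 - f) d\<Lambda>)\<close> for
  all measurable \<open>f\<close> with values in \<open>[0,1]\<close> (\<open>poisson_imp_functional\<close>, \<open>poisson_functional_imp_poisson\<close>).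
  In one direction, simple functions reduce the formula to independent Poisson counts and monotone
  limits extend it.  In the other, step functions give the joint generating function of the counts,
  whose power series coefficients are the joint law.  In terms of these functionals, independent
  marking only averages the test function over the mark.

  That \<open>\<nu>\<close> has density \<open>B'\<close> needs more than monotonicity of \<open>B\<close>: as \<open>H\<close> has a density and \<open>t \<mapsto> 1 / (t c)\<close>
  preserves null sets, \<open>\<nu>\<close> is absolutely continuous, and by Lebesgue's differentiation theorem its
  Radon-Nikodym density is almost everywhere the derivative of its distribution function
  (\<open>absolutely_continuous_eq_density_deriv\<close>).  Finally, \<open>B\<close> is continuous and vanishes at \<open>0\<close>, and it is
  unbounded because the total mass of \<open>\<nu>\<close> is the area of the plane.
\<close>

section \<open>Generating functions of Poisson counts\<close>

text \<open>The probability \<open>exp(-x)\<close> that a Poisson variable of possibly infinite mean \<open>x\<close> vanishes, with \<open>exp(-\<infinity>) = 0\<close>.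
  This convention lets a Poisson law of infinite mean, whose mass sits at \<open>\<infinity>\<close>, obey the same
  formulas as the finite ones.\<close>
definition exp_neg :: "ennreal \<Rightarrow> real" where
  "exp_neg x = (if x = \<top> then 0 else exp (- enn2real x))"

lemma exp_neg_0 [simp]: "exp_neg 0 = 1"
  by (simp add: exp_neg_def)

lemma exp_neg_add: "exp_neg (x + y) = exp_neg x * exp_neg y"
  by (auto simp: exp_neg_def enn2real_plus less_top[symmetric] simp flip: exp_add)

lemma exp_neg_sum: "exp_neg (sum f I) = (\<Prod>i\<in>I. exp_neg (f i))"
  by (induction I rule: infinite_finite_induct) (auto simp: exp_neg_add)

lemma tendsto_exp_neg:
  assumes "(f \<longlongrightarrow> x) F"
  shows "((\<lambda>n. exp_neg (f n)) \<longlongrightarrow> exp_neg x) F"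
proof (cases "x = \<top>")
  case False
  then obtain l where l: "x = ennreal l" "l \<ge> 0"
    by (metis ennreal_cases)
  have "eventually (\<lambda>n. f n < \<top>) F"
    using order_tendstoD(2)[OF assms] False by (simp add: less_top)
  moreover have "((\<lambda>n. exp (- enn2real (f n))) \<longlongrightarrow> exp (- l)) F"
    using assms unfolding l(1) by (intro tendsto_intros l(2))
  ultimately show ?thesis
    using l False by (auto simp: exp_neg_def elim!: Lim_transform_eventually eventually_mono)
next
  case True
  have "((\<lambda>n. exp_neg (f n)) \<longlongrightarrow> 0) F"
  proof (rule order_tendstoI)
    fix a :: real assume "a < 0"
    then show "eventually (\<lambda>n. a < exp_neg (f n)) F"
      by (auto simp: exp_neg_def intro!: always_eventually less_trans[OF _ exp_gt_zero])
  next
    fix e :: real assume e: "0 < e"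
    have "eventually (\<lambda>n. ennreal (- ln e) < f n) F"
      using order_tendstoD(1)[OF assms] True by simp
    then show "eventually (\<lambda>n. exp_neg (f n) < e) F"
    proof eventually_elim
      case (elim n)
      show ?case
      proof (cases "f n = \<top>")
        case True
        then show ?thesis by (simp add: exp_neg_def e)
      next
        case False
        then obtain l where l: "f n = ennreal l" "l \<ge> 0"
          by (metis ennreal_cases)
        with elim have "- ln e < l"
          by (metis ennreal_leI leD not_le_imp_less)
        then have "exp (- l) < exp (ln e)"
          by (subst exp_less_cancel_iff) simp
        with l e show ?thesis
          by (simp add: exp_neg_def)
      qed
    qed
  qed
  then show ?thesis
    using True by (simp add: exp_neg_def)
qed

text \<open>The power \<open>u\<^sup>N\<close> of \<open>u \<in> [0,1]\<close> to a count \<open>N \<in> {0, 1, \<dots>, \<infinity>}\<close>, with \<open>1\<^sup>\<infinity> = 1\<close>, \<open>u\<^sup>\<infinity> = 0\<close> for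
  \<open>u < 1\<close>, and \<open>0\<^sup>0 = 1\<close>: it is the infinite product of one factor \<open>u\<close> for each counted point.  The
  floor only turns a finite extended real back into a natural number.\<close>
definition count_power :: "real \<Rightarrow> ennreal \<Rightarrow> real" where
  "count_power u N = (if N = \<top> then of_bool (u = 1) else u ^ nat \<lfloor>enn2real N\<rfloor>)"

lemma count_power_simps [simp]:
  "count_power u \<top> = of_bool (u = 1)" "count_power u (of_nat k) = u ^ k" "count_power 1 N = 1"
proof -
  have "enn2real (of_nat k) = real k" for k
    by (simp add: ennreal_of_nat_eq_real_of_nat)
  then show "count_power u (of_nat k) = u ^ k"
    by (auto simp: count_power_def)
qed (auto simp: count_power_def)

lemma measurable_count_power [measurable]: "count_power u \<in> borel_measurable borel"
  unfolding count_power_def[abs_def] by measurable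

lemma count_power_nonneg: "0 \<le> u \<Longrightarrow> 0 \<le> count_power u N"
  and count_power_le_1: "0 \<le> u \<Longrightarrow> u \<le> 1 \<Longrightarrow> count_power u N \<le> 1"
  by (auto simp: count_power_def power_le_one)

definition poisson_weight :: "ennreal \<Rightarrow> nat \<Rightarrow> real" where
  "poisson_weight l k = (if l = \<infinity> then 0 else exp (- enn2real l) * enn2real l ^ k / fact k)"

text \<open>For \<open>u < 1\<close> the formula also covers an infinite mean, since then every finite count has weight \<open>0\<close>
  and \<open>(1 - u) \<cdot> \<infinity> = \<infinity>\<close>.  At \<open>u = 1\<close> the two sides are \<open>0\<close> and \<open>1\<close> for infinite mean, because the
  series does not see the mass at \<open>\<infinity>\<close>.\<close>
lemma poisson_generating_function:
  assumes "0 \<le> u" "u < 1"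
  shows "(\<lambda>k. poisson_weight l k * u ^ k) sums exp_neg (ennreal (1 - u) * l)"
proof (cases "l = \<top>")
  case True
  with assms show ?thesis
    by (simp add: poisson_weight_def exp_neg_def ennreal_mult_top)
next
  case False
  then obtain r where r: "l = ennreal r" "r \<ge> 0"
    by (metis ennreal_cases)
  have "(\<lambda>k. exp (- r) * ((r * u) ^ k /\<^sub>R fact k)) sums (exp (- r) * exp (r * u))"
    by (intro sums_mult exp_converges)
  moreover have "exp (- r) * exp (r * u) = exp_neg (ennreal (1 - u) * l)"
    using assms r by (simp add: exp_neg_def ennreal_mult_eq_top_iff enn2real_mult algebra_simps flip: exp_add)
  ultimately show ?thesis
    using r by (simp add: poisson_weight_def power_mult_distrib divide_inverse algebra_simps)
qed

lemma point_count_eq: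
  "point_count X A \<omega> = (if finite {i. X i \<omega> \<in> A} then of_nat (card {i. X i \<omega> \<in> A}) else \<top>)"
proof -
  have "point_count X A \<omega> = (\<integral>\<^sup>+i. indicator A (X i \<omega>) \<partial>count_space UNIV)"
    by (simp add: point_count_def nn_integral_count_space_nat)
  also have "\<dots> = (\<integral>\<^sup>+i. indicator {i. X i \<omega> \<in> A} i \<partial>count_space UNIV)"
    by (intro nn_integral_cong) (simp split: split_indicator)
  also have "\<dots> = emeasure (count_space UNIV) {i. X i \<omega> \<in> A}"
    by simp
  finally show ?thesis
    by (simp add: emeasure_count_space)
qed

lemma measurable_point_count [measurable]:
  assumes "\<And>i. X i \<in> measurable M \<Lambda>" "A \<in> sets \<Lambda>"
  shows "point_count X A \<in> borel_measurable M"
  unfolding point_count_def[abs_def] using assms by measurable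

text \<open>Finite products over the first \<open>m\<close> points are measurable and easy to integrate; this limit is how
  they carry information about the counts.\<close>
lemma prod_tendsto_count_power:
  assumes "0 \<le> u" "u \<le> 1"
  shows "(\<lambda>m. \<Prod>i<m. if X i \<omega> \<in> A then u else 1) \<longlonglongrightarrow> count_power u (point_count X A \<omega>)"
proof -
  define I where "I = {i. X i \<omega> \<in> A}"
  have prod_eq: "(\<Prod>i<m. if X i \<omega> \<in> A then u else 1) = u ^ card (I \<inter> {..<m})" for m
    by (simp add: prod.If_cases I_def Int_commute)
  show ?thesis
  proof (cases "finite I")
    case True
    then obtain m0 where "\<And>i. i \<in> I \<Longrightarrow> i < m0"
      by (auto simp: finite_nat_set_iff_bounded)
    then have "I \<inter> {..<m} = I" if "m \<ge> m0" for m
      using that by force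
    then have "eventually (\<lambda>m. u ^ card (I \<inter> {..<m}) = u ^ card I) sequentially"
      by (auto simp: eventually_sequentially intro!: exI[of _ m0])
    with True show ?thesis
      unfolding prod_eq by (simp add: point_count_eq flip: I_def) (rule tendsto_eventually)
  next
    case False
    have "filterlim (\<lambda>m. card (I \<inter> {..<m})) at_top sequentially"
      unfolding filterlim_at_top eventually_sequentially
    proof
      fix k
      obtain T where T: "T \<subseteq> I" "finite T" "card T = k"
        using infinite_arbitrarily_large[OF False] by blast
      then obtain m0 where m0: "\<And>i. i \<in> T \<Longrightarrow> i < m0"
        by (auto simp: finite_nat_set_iff_bounded)
      have "k \<le> card (I \<inter> {..<m})" if "m0 \<le> m" for m
        unfolding T(3)[symmetric] using m0 that T(1) by (intro card_mono) force+
      then show "\<exists>N. \<forall>n\<ge>N. k \<le> card (I \<inter> {..<n})"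
        by auto
    qed
    then have "u < 1 \<Longrightarrow> (\<lambda>m. u ^ card (I \<inter> {..<m})) \<longlonglongrightarrow> 0"
      using assms by (intro filterlim_compose[OF LIMSEQ_power_zero]) auto
    with False assms show ?thesis
      unfolding prod_eq by (cases "u = 1") (auto simp: point_count_eq simp flip: I_def)
  qed
qed

text \<open>The weight \<open>W\<close> stands for whatever is known about the other cells.  Thanks to it, one cell at
  a time can be turned from its generating function into its distribution, so that power series in
  one variable suffice for joint laws.  For \<open>u < 1\<close> the event \<open>N = \<infinity>\<close> contributes to neither side.\<close>
lemma (in prob_space) expectation_count_power_sums:
  assumes N [measurable]: "N \<in> borel_measurable M" and N_nat: "\<And>\<omega>. N \<omega> \<in> insert \<top> (range of_nat)"
    and W [measurable]: "W \<in> borel_measurable M" and W_bd: "\<And>\<omega>. \<bar>W \<omega>\<bar> \<le> (1::real)"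
    and u: "0 \<le> u" "u < 1"
  shows "(\<lambda>k. expectation (\<lambda>\<omega>. indicator {of_nat k} (N \<omega>) * W \<omega>) * u ^ k)
           sums expectation (\<lambda>\<omega>. count_power u (N \<omega>) * W \<omega>)"
proof -
  let ?f = "\<lambda>k \<omega>. u ^ k * (indicator {of_nat k} (N \<omega>) * W \<omega>)"
  have f_bd: "\<bar>?f k \<omega>\<bar> \<le> u ^ k" for k \<omega>
    using u W_bd[of \<omega>] by (auto simp: abs_mult mult_left_le split: split_indicator)
  have int: "integrable M (?f k)" for k
    by (rule integrable_const_bound[where B="u ^ k"]) (use f_bd in auto)
  have geo: "summable (\<lambda>k. u ^ k)"
    using u by (simp add: summable_geometric)
  have "(\<lambda>k. integral\<^sup>L M (?f k)) sums (\<integral>\<omega>. (\<Sum>k. ?f k \<omega>) \<partial>M)"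
  proof (rule sums_integral[OF int])
    show "AE \<omega> in M. summable (\<lambda>k. norm (?f k \<omega>))"
      using f_bd by (intro AE_I2 summable_comparison_test'[OF geo]) auto
    have "norm (\<integral>\<omega>. norm (?f k \<omega>) \<partial>M) \<le> u ^ k" for k
    proof -
      have "norm (\<integral>\<omega>. norm (?f k \<omega>) \<partial>M) = (\<integral>\<omega>. norm (?f k \<omega>) \<partial>M)"
        by (simp add: integral_nonneg_AE)
      also have "\<dots> \<le> (\<integral>\<omega>. u ^ k \<partial>M)"
        using int f_bd by (intro integral_mono) auto
      finally show ?thesis by (simp add: prob_space)
    qed
    then show "summable (\<lambda>k. \<integral>\<omega>. norm (?f k \<omega>) \<partial>M)"
      by (intro summable_comparison_test'[OF geo]) auto
  qed
  moreover have "(\<Sum>k. ?f k \<omega>) = count_power u (N \<omega>) * W \<omega>" for \<omega>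
  proof (cases "N \<omega> = \<top>")
    case True
    have "indicator {of_nat k} (\<top> :: ennreal) = (0::real)" for k
      by (auto simp: indicator_def)
    with True u show ?thesis by auto
  next
    case False
    then obtain n where n: "N \<omega> = of_nat n"
      using N_nat[of \<omega>] by auto
    have "(\<Sum>k. ?f k \<omega>) = (\<Sum>k\<in>{n}. ?f k \<omega>)"
      by (rule suminf_finite) (auto simp: n)
    then show ?thesis by (simp add: n)
  qed
  ultimately show ?thesis
    by (simp add: mult.commute)
qed

text \<open>Bounded coefficients give radius of convergence at least \<open>1\<close>; the lowest nonzero coefficient of the
  difference would be its limit at \<open>0\<close> after division by the corresponding power.\<close>
lemma power_series_eq_right_imp_eq:
  fixes a b :: "nat \<Rightarrow> real"
  assumes ba: "\<And>k. \<bar>a k\<bar> \<le> C" and bb: "\<And>k. \<bar>b k\<bar> \<le> C"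
    and eq: "\<And>u. 0 < u \<Longrightarrow> u < 1 \<Longrightarrow> (\<Sum>k. a k * u ^ k) = (\<Sum>k. b k * u ^ k)"
  shows "a = b"
proof -
  define c where "c k = a k - b k" for k
  have sm: "summable (\<lambda>k. d k * u ^ k)" if "\<And>k. \<bar>d k\<bar> \<le> D" "\<bar>u\<bar> < 1" for d :: "nat \<Rightarrow> real" and u D
  proof (rule summable_comparison_test')
    show "summable (\<lambda>k. D * \<bar>u\<bar> ^ k)"
      using that by (intro summable_mult summable_geometric) auto
    show "norm (d n * u ^ n) \<le> D * \<bar>u\<bar> ^ n" if "n \<ge> 0" for n
      using \<open>\<And>k. \<bar>d k\<bar> \<le> D\<close>[of n] by (auto simp: abs_mult power_abs intro!: mult_right_mono)
  qed
  have c_bd: "\<bar>c k\<bar> \<le> 2 * C" for k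
    using ba[of k] bb[of k] by (auto simp: c_def)
  have c_sum: "(\<lambda>k. c k * u ^ k) sums 0" if "0 < u" "u < 1" for u
  proof -
    have "(\<lambda>k. a k * u ^ k - b k * u ^ k) sums ((\<Sum>k. a k * u ^ k) - (\<Sum>k. b k * u ^ k))"
      using that by (intro sums_diff summable_sums sm[OF ba] sm[OF bb]) auto
    then show ?thesis
      using eq[OF that] by (simp add: c_def algebra_simps)
  qed
  have "c n = 0" for n
  proof (induction n rule: less_induct)
    case (less n)
    let ?f = "\<lambda>u. \<Sum>k. c (k + n) * u ^ k"
    have "(?f \<longlongrightarrow> c (0 + n)) (at 0)"
      by (rule powser_limit_0[where s=1 and a="\<lambda>k. c (k + n)"])
         (auto intro!: summable_sums sm[where D="2 * C"] c_bd)
    then have "(?f \<longlongrightarrow> c n) (at_right 0)"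
      by (simp add: filterlim_at_split)
    moreover have "eventually (\<lambda>u. ?f u = 0) (at_right 0)"
    proof -
      have "?f u = 0" if u: "0 < u" "u < 1" for u
      proof -
        have "(\<lambda>k. c (k + n) * u ^ (k + n)) sums 0"
          using c_sum[OF u] sums_iff_shift[of "\<lambda>k. c k * u ^ k" n 0] less by simp
        then have "(\<lambda>k. c (k + n) * u ^ (k + n) / u ^ n) sums (0 / u ^ n)"
          by (rule sums_divide)
        then show ?thesis
          using u by (simp add: power_add sums_iff)
      qed
      then show ?thesis
        by (auto simp: eventually_at_right_field intro!: exI[of _ 1])
    qed
    then have "(?f \<longlongrightarrow> 0) (at_right 0)"
      by (rule tendsto_eventually)
    ultimately show "c n = 0"
      using tendsto_unique trivial_limit_at_right_real by blast
  qed
  then show ?thesis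
    by (auto simp: c_def fun_eq_iff)
qed

section \<open>The generating functional of a Poisson process\<close>

text \<open>The probability generating functional \<open>E \<Prod>\<^sub>i f(X\<^sub>i)\<close>, truncated to the first \<open>m\<close> points.  Keeping the
  truncation avoids infinite products, and for \<open>0 \<le> f \<le> 1\<close> the functional itself is the limit.\<close>
definition generating_functional ::
    "'w measure \<Rightarrow> (nat \<Rightarrow> 'w \<Rightarrow> 'a) \<Rightarrow> ('a \<Rightarrow> real) \<Rightarrow> nat \<Rightarrow> real" where
  "generating_functional M X f m = (\<integral>\<omega>. (\<Prod>i<m. f (X i \<omega>)) \<partial>M)"

definition poisson_functional_on ::
    "'w measure \<Rightarrow> 'a measure \<Rightarrow> (nat \<Rightarrow> 'w \<Rightarrow> 'a) \<Rightarrow> ('a \<Rightarrow> real) \<Rightarrow> bool" where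
  "poisson_functional_on M \<Lambda> X f \<longleftrightarrow>
     generating_functional M X f \<longlonglongrightarrow> exp_neg (\<integral>\<^sup>+x. ennreal (1 - f x) \<partial>\<Lambda>)"

lemma prod_unit_interval:
  fixes f :: "'i \<Rightarrow> real"
  assumes "\<And>i. i \<in> I \<Longrightarrow> 0 \<le> f i \<and> f i \<le> 1"
  shows "0 \<le> prod f I" "prod f I \<le> 1"
  using assms by (auto intro!: prod_nonneg prod_le_1)

context prob_space
begin

text \<open>A point \<open>X\<^sub>i\<close> contributes the factor \<open>u\<^sub>j\<close> for each cell \<open>A\<^sub>j\<close> containing it, so the product over all
  points collects \<open>u\<^sub>j\<close> to the power \<open>N(A\<^sub>j)\<close>; bounded convergence moves the limit out of the
  expectation.\<close>
lemma generating_functional_step_function: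
  assumes X [measurable]: "\<And>i. X i \<in> measurable M \<Lambda>"
    and J: "finite J" and A [measurable]: "\<And>j. j \<in> J \<Longrightarrow> A j \<in> sets \<Lambda>"
    and u: "\<And>j. j \<in> J \<Longrightarrow> 0 \<le> u j \<and> u j \<le> 1"
  shows "generating_functional M X (\<lambda>x. \<Prod>j\<in>J. if x \<in> A j then u j else 1)
           \<longlonglongrightarrow> expectation (\<lambda>\<omega>. \<Prod>j\<in>J. count_power (u j) (point_count X (A j) \<omega>))"
  unfolding generating_functional_def[abs_def]
proof (rule integral_dominated_convergence[where w="\<lambda>_. 1"])
  show "(\<lambda>\<omega>. \<Prod>j\<in>J. count_power (u j) (point_count X (A j) \<omega>)) \<in> borel_measurable M"
  proof (rule borel_measurable_prod)
    fix j assume "j \<in> J"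
    then have "point_count X (A j) \<in> borel_measurable M"
      using X A by (intro measurable_point_count[where \<Lambda>=\<Lambda>]) auto
    then show "(\<lambda>\<omega>. count_power (u j) (point_count X (A j) \<omega>)) \<in> borel_measurable M"
      by measurable
  qed
  show "(\<lambda>\<omega>. \<Prod>i<m. \<Prod>j\<in>J. if X i \<omega> \<in> A j then u j else 1) \<in> borel_measurable M" for m
    by measurable
  show "AE \<omega> in M. (\<lambda>m. \<Prod>i<m. \<Prod>j\<in>J. if X i \<omega> \<in> A j then u j else 1)
          \<longlonglongrightarrow> (\<Prod>j\<in>J. count_power (u j) (point_count X (A j) \<omega>))"
  proof (rule AE_I2)
    fix \<omega>
    have "(\<lambda>m. \<Prod>j\<in>J. \<Prod>i<m. if X i \<omega> \<in> A j then u j else 1)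
          \<longlonglongrightarrow> (\<Prod>j\<in>J. count_power (u j) (point_count X (A j) \<omega>))"
      using u by (intro tendsto_prod prod_tendsto_count_power) auto
    then show "(\<lambda>m. \<Prod>i<m. \<Prod>j\<in>J. if X i \<omega> \<in> A j then u j else 1)
          \<longlonglongrightarrow> (\<Prod>j\<in>J. count_power (u j) (point_count X (A j) \<omega>))"
      by (subst prod.swap)
  qed
  show "AE \<omega> in M. norm (\<Prod>i<m. \<Prod>j\<in>J. if X i \<omega> \<in> A j then u j else 1) \<le> 1" for m
  proof (rule AE_I2)
    fix \<omega>
    let ?p = "\<lambda>i. \<Prod>j\<in>J. if X i \<omega> \<in> A j then u j else 1"
    have p: "0 \<le> ?p i \<and> ?p i \<le> 1" for i
      using prod_unit_interval[of J "\<lambda>j. if X i \<omega> \<in> A j then u j else 1"] u by auto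
    show "norm (\<Prod>i<m. ?p i) \<le> 1"
      using prod_unit_interval[of "{..<m}" ?p] p by simp
  qed
qed simp

lemma nn_integral_step_function:
  assumes J: "finite J" and A [measurable]: "\<And>j. j \<in> J \<Longrightarrow> A j \<in> sets \<Lambda>"
    and disj: "disjoint_family_on A J"
    and u: "\<And>j. j \<in> J \<Longrightarrow> 0 \<le> u j \<and> u j \<le> 1"
  shows "(\<integral>\<^sup>+x. ennreal (1 - (\<Prod>j\<in>J. if x \<in> A j then u j else 1)) \<partial>\<Lambda>)
           = (\<Sum>j\<in>J. ennreal (1 - u j) * emeasure \<Lambda> (A j))"
proof -
  have eq: "ennreal (1 - (\<Prod>j\<in>J. if x \<in> A j then u j else 1))
      = (\<Sum>j\<in>J. ennreal (1 - u j) * indicator (A j) x)" for x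
  proof (cases "\<exists>j\<in>J. x \<in> A j")
    case True
    then obtain j where j: "j \<in> J" "x \<in> A j" by blast
    have other: "x \<notin> A i" if "i \<in> J - {j}" for i
      using disj j that by (auto simp: disjoint_family_on_def)
    have "(\<Prod>i\<in>J. if x \<in> A i then u i else 1) = u j"
      using J j other by (subst prod.remove[of _ j]) (auto intro!: prod.neutral)
    moreover have "(\<Sum>i\<in>J. ennreal (1 - u i) * indicator (A i) x) = ennreal (1 - u j)"
      using J j other by (subst sum.remove[of _ j]) (auto intro!: sum.neutral)
    ultimately show ?thesis by simp
  next
    case False
    then have "(\<Prod>i\<in>J. if x \<in> A i then u i else 1) = 1"
      "(\<Sum>i\<in>J. ennreal (1 - u i) * indicator (A i) x) = 0"
      by (auto intro!: prod.neutral sum.neutral)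
    then show ?thesis by simp
  qed
  have "(\<integral>\<^sup>+x. (\<Sum>j\<in>J. ennreal (1 - u j) * indicator (A j) x) \<partial>\<Lambda>)
      = (\<Sum>j\<in>J. \<integral>\<^sup>+x. ennreal (1 - u j) * indicator (A j) x \<partial>\<Lambda>)"
    by (rule nn_integral_sum) (use A in measurable)
  also have "\<dots> = (\<Sum>j\<in>J. ennreal (1 - u j) * emeasure \<Lambda> (A j))"
    by (intro sum.cong refl nn_integral_cmult_indicator A)
  finally show ?thesis
    by (simp add: eq)
qed

text \<open>The value \<open>u = 1\<close> is trivial, and it has to be treated apart from the power series when the mean
  is infinite.\<close>
lemma expectation_count_power_poisson:
  assumes N [measurable]: "N \<in> borel_measurable M" and N_nat: "\<And>\<omega>. N \<omega> \<in> insert \<top> (range of_nat)"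
    and dist: "\<And>k. prob {\<omega> \<in> space M. N \<omega> = of_nat k} = poisson_weight l k"
    and u: "0 \<le> u" "u \<le> 1"
  shows "expectation (\<lambda>\<omega>. count_power u (N \<omega>)) = exp_neg (ennreal (1 - u) * l)"
proof (cases "u = 1")
  case True
  then show ?thesis by (simp add: prob_space)
next
  case False
  have "expectation (\<lambda>\<omega>. indicator {of_nat k} (N \<omega>) * 1) = poisson_weight l k" for k
  proof -
    have "expectation (\<lambda>\<omega>. indicator {of_nat k} (N \<omega>) * 1)
        = expectation (indicator {\<omega> \<in> space M. N \<omega> = of_nat k} :: _ \<Rightarrow> real)"
      by (intro Bochner_Integration.integral_cong) (auto simp: indicator_def)
    also have "\<dots> = prob {\<omega> \<in> space M. N \<omega> = of_nat k}"
      by (subst Bochner_Integration.integral_indicator) (auto simp: Int_absorb2)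
    finally show ?thesis
      using dist by simp
  qed
  then show ?thesis
    using expectation_count_power_sums[OF N N_nat, of "\<lambda>_. 1" u]
      poisson_generating_function[of u l] u False
    by (auto intro: sums_unique2)
qed

text \<open>On its level sets a simple function is a step function with disjoint cells; independence of the
  counts turns the expectation of the product into a product of Poisson generating functions.\<close>
lemma poisson_imp_functional_simple:
  assumes ppp: "poisson_point_process_on M (space \<Lambda>) \<Lambda> X"
    and f: "simple_function \<Lambda> f" and f01: "\<And>x. 0 \<le> f x \<and> f x \<le> (1::real)"
  shows "poisson_functional_on M \<Lambda> X f"
proof -
  have X [measurable]: "\<And>i. X i \<in> measurable M \<Lambda>"
    using ppp by (auto simp: poisson_point_process_on_def)
  have fin: "finite (f ` space \<Lambda>)"
    using f by (rule simple_functionD)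
  define n where "n = card (f ` space \<Lambda>)"
  obtain e where e: "bij_betw e {..<n} (f ` space \<Lambda>)"
    using ex_bij_betw_nat_finite[OF fin] by (auto simp: n_def atLeast0LessThan)
  define A where "A j = f -` {e j} \<inter> space \<Lambda>" for j
  have A: "A j \<in> sets \<Lambda>" "A j \<subseteq> space \<Lambda>" for j
    using simple_functionD(2)[OF f] by (auto simp: A_def)
  have disj: "disjoint_family_on A {..<n}"
    using inj_on_eq_iff[OF bij_betw_imp_inj_on[OF e]] by (auto simp: disjoint_family_on_def A_def)
  have e01: "0 \<le> e j \<and> e j \<le> 1" if "j < n" for j
  proof -
    have "e j \<in> f ` space \<Lambda>"
      by (rule bspec[OF bij_betwE[OF e]]) (simp add: that)
    then show ?thesis
      by (rule imageE) (simp add: f01)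
  qed
  have f_eq: "f x = (\<Prod>j<n. if x \<in> A j then e j else 1)" if x: "x \<in> space \<Lambda>" for x
  proof -
    have "f x \<in> e ` {..<n}"
      using bij_betw_imp_surj_on[OF e] x by simp
    then obtain j where j: "j < n" "f x = e j"
      by auto
    have "x \<in> A i \<longleftrightarrow> i = j" if "i < n" for i
      using inj_on_eq_iff[OF bij_betw_imp_inj_on[OF e], of j i] j x that by (auto simp: A_def)
    then have "(\<Prod>i<n. if x \<in> A i then e i else 1) = (\<Prod>i<n. if i = j then e i else 1)"
      by (intro prod.cong) auto
    also have "\<dots> = e j"
      using j by simp
    finally show ?thesis using j by simp
  qed
  have N_meas: "point_count X (A j) \<in> borel_measurable M" for j
    by (intro measurable_point_count[where \<Lambda>=\<Lambda>] X A)
  have N_nat: "point_count X (A j) \<omega> \<in> insert \<top> (range of_nat)" for j \<omega>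
    by (simp add: point_count_eq)
  have N_dist: "prob {\<omega> \<in> space M. point_count X (A j) \<omega> = of_nat k} = poisson_weight (emeasure \<Lambda> (A j)) k" for j k
  proof -
    have "\<forall>A \<in> sets \<Lambda>. A \<subseteq> space \<Lambda> \<longrightarrow> (\<forall>k::nat.
        prob {\<omega> \<in> space M. point_count X A \<omega> = of_nat k} =
          (if emeasure \<Lambda> A = \<infinity> then 0
           else exp (- measure \<Lambda> A) * measure \<Lambda> A ^ k / fact k))"
      using ppp unfolding poisson_point_process_on_def by (elim conjE) assumption
    from bspec[OF this A(1), of j] A(2)[of j] show ?thesis
      by (simp add: poisson_weight_def measure_def)
  qed
  have "indep_vars (\<lambda>_. borel) (\<lambda>j. point_count X (A j)) {..<n}"
  proof -
    have "\<forall>(n::nat) A. (\<forall>j<n. A j \<in> sets \<Lambda> \<and> A j \<subseteq> space \<Lambda>) \<and> disjoint_family_on A {..<n} \<longrightarrow>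
        indep_vars (\<lambda>_. borel) (\<lambda>j. point_count X (A j)) {..<n}"
      using ppp unfolding poisson_point_process_on_def by (elim conjE) assumption
    then show ?thesis
      using A disj by (metis (no_types, lifting))
  qed
  then have indep: "indep_vars (\<lambda>_. borel) (\<lambda>j \<omega>. count_power (e j) (point_count X (A j) \<omega>)) {..<n}"
    by (rule indep_vars_compose2) measurable
  have "expectation (\<lambda>\<omega>. \<Prod>j<n. count_power (e j) (point_count X (A j) \<omega>))
      = (\<Prod>j<n. expectation (\<lambda>\<omega>. count_power (e j) (point_count X (A j) \<omega>)))"
  proof (rule indep_vars_lebesgue_integral[OF _ indep])
    fix j assume "j \<in> {..<n}"
    then show "integrable M (\<lambda>\<omega>. count_power (e j) (point_count X (A j) \<omega>))"
      using e01[of j] N_meas[of j]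
      by (intro integrable_const_bound[where B=1]) (auto simp: count_power_nonneg count_power_le_1)
  qed simp
  also have "\<dots> = (\<Prod>j<n. exp_neg (ennreal (1 - e j) * emeasure \<Lambda> (A j)))"
    using e01 by (intro prod.cong refl expectation_count_power_poisson N_meas N_nat N_dist) auto
  also have "\<dots> = exp_neg (\<integral>\<^sup>+x. ennreal (1 - f x) \<partial>\<Lambda>)"
    using nn_integral_step_function[of "{..<n}" A \<Lambda> e] A disj e01
    by (simp add: exp_neg_sum f_eq cong: nn_integral_cong)
  finally have E: "expectation (\<lambda>\<omega>. \<Prod>j<n. count_power (e j) (point_count X (A j) \<omega>))
      = exp_neg (\<integral>\<^sup>+x. ennreal (1 - f x) \<partial>\<Lambda>)" .
  have gf_eq: "generating_functional M X f
      = generating_functional M X (\<lambda>x. \<Prod>j<n. if x \<in> A j then e j else 1)"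
    unfolding generating_functional_def[abs_def]
    using measurable_space[OF X] f_eq
    by (intro ext Bochner_Integration.integral_cong prod.cong refl) auto
  have "generating_functional M X (\<lambda>x. \<Prod>j<n. if x \<in> A j then e j else 1)
      \<longlonglongrightarrow> exp_neg (\<integral>\<^sup>+x. ennreal (1 - f x) \<partial>\<Lambda>)"
    unfolding E[symmetric] using A(1) e01 by (intro generating_functional_step_function[OF X]) auto
  then show ?thesis
    unfolding poisson_functional_on_def gf_eq .
qed

lemma integrable_prod_unit_interval:
  assumes X: "\<And>i. X i \<in> measurable M \<Lambda>" and f: "f \<in> borel_measurable \<Lambda>"
    and f01: "\<And>x. 0 \<le> f x \<and> f x \<le> (1::real)"
  shows "integrable M (\<lambda>\<omega>. \<Prod>i<m::nat. f (X i \<omega>))"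
proof (rule integrable_const_bound[where B=1])
  show "(\<lambda>\<omega>. \<Prod>i<m. f (X i \<omega>)) \<in> borel_measurable M"
    using X f by measurable
  show "AE \<omega> in M. norm (\<Prod>i<m. f (X i \<omega>)) \<le> 1"
  proof (rule AE_I2)
    fix \<omega>
    show "norm (\<Prod>i<m. f (X i \<omega>)) \<le> 1"
      using f01 prod_unit_interval[of "{..<m}" "\<lambda>i. f (X i \<omega>)"] by simp
  qed
qed

text \<open>Approximate \<open>f\<close> from above by simple functions \<open>g\<^sub>n\<close>.  The expectations of the truncated products of
  \<open>g\<^sub>n\<close> dominate those of \<open>f\<close> and decrease with the number \<open>m\<close> of factors; this monotonicity is what
  allows the limits in \<open>n\<close> and \<open>m\<close> to be interchanged.\<close>
lemma poisson_imp_functional: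
  assumes ppp: "poisson_point_process_on M (space \<Lambda>) \<Lambda> X"
    and f [measurable]: "f \<in> borel_measurable \<Lambda>" and f01: "\<And>x. 0 \<le> f x \<and> f x \<le> (1::real)"
  shows "poisson_functional_on M \<Lambda> X f"
proof -
  have X [measurable]: "\<And>i. X i \<in> measurable M \<Lambda>"
    using ppp by (auto simp: poisson_point_process_on_def)
  have "(\<lambda>x. ennreal (1 - f x)) \<in> borel_measurable \<Lambda>"
    by measurable
  then obtain U where U: "\<And>n. simple_function \<Lambda> (U n)" "incseq U" "\<And>n x. U n x < \<top>"
      "\<And>x. (SUP n. U n x) = ennreal (1 - f x)"
    using borel_measurable_implies_simple_function_sequence' by blast
  define g where "g n x = 1 - enn2real (U n x)" for n x
  have U_le: "U n x \<le> ennreal (1 - f x)" for n x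
    unfolding U(4)[symmetric] by (intro SUP_upper) simp
  have g_ge: "f x \<le> g n x" for n x
    using enn2real_mono[OF U_le[of n x]] f01[of x] by (simp add: g_def)
  have g01: "0 \<le> g n x \<and> g n x \<le> 1" for n x
    using g_ge[of x n] f01[of x] by (simp add: g_def)
  have g_simple: "simple_function \<Lambda> (g n)" for n
    unfolding g_def[abs_def] using simple_function_compose1[OF U(1), of "\<lambda>x. 1 - enn2real x" n] by simp
  have g_lim: "(\<lambda>n. g n x) \<longlonglongrightarrow> f x" for x
  proof -
    have "(\<lambda>n. U n x) \<longlonglongrightarrow> ennreal (1 - f x)"
      unfolding U(4)[symmetric] using U(2) by (intro LIMSEQ_SUP) (auto simp: incseq_def le_fun_def)
    then have "(\<lambda>n. 1 - enn2real (U n x)) \<longlonglongrightarrow> 1 - (1 - f x)"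
      using f01[of x] by (intro tendsto_intros) auto
    then show ?thesis by (simp add: g_def)
  qed
  have U_eq: "ennreal (1 - g n x) = U n x" for n x
    using U(3)[of n x] by (simp add: g_def)
  define a where "a = generating_functional M X f"
  define b where "b n = generating_functional M X (g n)" for n
  define c where "c = exp_neg (\<integral>\<^sup>+x. ennreal (1 - f x) \<partial>\<Lambda>)"
  define d where "d n = exp_neg (\<integral>\<^sup>+x. U n x \<partial>\<Lambda>)" for n
  have b_lim: "b n \<longlonglongrightarrow> d n" for n
    using poisson_imp_functional_simple[OF ppp g_simple, of n] g01
    by (simp add: poisson_functional_on_def b_def d_def U_eq)
  have d_lim: "d \<longlonglongrightarrow> c"
  proof -
    have "(\<lambda>n. \<integral>\<^sup>+x. U n x \<partial>\<Lambda>) \<longlonglongrightarrow> (SUP n. \<integral>\<^sup>+x. U n x \<partial>\<Lambda>)"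
      using U(2) by (intro LIMSEQ_SUP) (auto simp: incseq_def le_fun_def intro!: nn_integral_mono)
    also have "(SUP n. \<integral>\<^sup>+x. U n x \<partial>\<Lambda>) = (\<integral>\<^sup>+x. ennreal (1 - f x) \<partial>\<Lambda>)"
      using U(1,2) by (subst nn_integral_monotone_convergence_SUP[symmetric])
        (auto simp: U(4) intro: borel_measurable_simple_function)
    finally show ?thesis
      unfolding d_def c_def by (rule tendsto_exp_neg)
  qed
  have g_meas [measurable]: "g n \<in> borel_measurable \<Lambda>" for n
    using g_simple by (rule borel_measurable_simple_function)
  have f_int: "integrable M (\<lambda>\<omega>. \<Prod>i<m. f (X i \<omega>))"
    and g_int: "integrable M (\<lambda>\<omega>. \<Prod>i<m. g n (X i \<omega>))" for m n
    by (rule integrable_prod_unit_interval[OF X f f01] integrable_prod_unit_interval[OF X g_meas g01])+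
  have ab: "a m \<le> b n m" for m n
    unfolding a_def b_def generating_functional_def
    by (intro integral_mono f_int g_int prod_mono conjI) (simp_all add: f01 g_ge)
  \<comment> \<open>Each further factor is at most one, so the truncated products decrease to their limit.\<close>
  have b_ge: "d n \<le> b n m" for m n
  proof -
    have "antimono (b n)"
      unfolding antimono_iff_le_Suc b_def generating_functional_def
    proof (intro allI integral_mono g_int)
      fix m \<omega>
      show "(\<Prod>i<Suc m. g n (X i \<omega>)) \<le> (\<Prod>i<m. g n (X i \<omega>))"
        using g01 prod_unit_interval[of "{..<m}" "\<lambda>i. g n (X i \<omega>)"] by (simp add: mult_left_le)
    qed
    then show ?thesis
      using b_lim by (rule decseq_ge)
  qed
  have ba: "(\<lambda>n. b n m) \<longlonglongrightarrow> a m" for m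
    unfolding a_def b_def generating_functional_def
  proof (rule integral_dominated_convergence[where w="\<lambda>_. 1"])
    show "AE \<omega> in M. (\<lambda>n. \<Prod>i<m. g n (X i \<omega>)) \<longlonglongrightarrow> (\<Prod>i<m. f (X i \<omega>))"
      by (intro AE_I2 tendsto_prod g_lim)
    show "AE \<omega> in M. norm (\<Prod>i<m. g n (X i \<omega>)) \<le> 1" for n
    proof (rule AE_I2)
      fix \<omega>
      show "norm (\<Prod>i<m. g n (X i \<omega>)) \<le> 1"
        using g01 prod_unit_interval[of "{..<m}" "\<lambda>i. g n (X i \<omega>)"] by simp
    qed
  qed (use f_int g_int in \<open>simp_all add: borel_measurable_integrable\<close>)
  have a_ge: "c \<le> a m" for m
    by (rule LIMSEQ_le[OF d_lim ba]) (simp add: b_ge)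
  have "a \<longlonglongrightarrow> c"
  proof (rule order_tendstoI)
    fix y assume "y < c"
    then show "eventually (\<lambda>m. y < a m) sequentially"
      by (intro always_eventually allI) (rule less_le_trans[OF _ a_ge])
  next
    fix y assume "c < y"
    then have "eventually (\<lambda>n. d n < y) sequentially"
      by (rule order_tendstoD(2)[OF d_lim])
    then obtain n where "d n < y"
      by (auto simp: eventually_sequentially)
    then have "eventually (\<lambda>m. b n m < y) sequentially"
      by (rule order_tendstoD(2)[OF b_lim])
    then show "eventually (\<lambda>m. a m < y) sequentially"
      by (rule eventually_mono) (rule le_less_trans[OF ab])
  qed
  then show ?thesis
    by (simp add: poisson_functional_on_def a_def c_def)
qed

end

section \<open>Recovering a Poisson process from its generating functional\<close>

context prob_space
begin

text \<open>A joint generating function that factorises determines the joint law.  Induct on the set \<open>K\<close> of cells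
  already converted: with the other cells still carrying a power \<open>u\<^sub>j\<close> to the \<open>N\<^sub>j\<close>, both sides are
  power series in the parameter of the next cell, and comparing coefficients converts it.  At the end
  \<open>u\<^sub>j = 1\<close> removes the cells outside \<open>K\<close>.\<close>
lemma joint_distribution_from_generating_function:
  assumes J: "finite J" and N [measurable]: "\<And>j. j \<in> J \<Longrightarrow> N j \<in> borel_measurable M"
    and N_nat: "\<And>j \<omega>. j \<in> J \<Longrightarrow> N j \<omega> \<in> insert \<top> (range of_nat)"
    and p_bd: "\<And>j k. j \<in> J \<Longrightarrow> \<bar>p j k\<bar> \<le> 1"
    and p_sums: "\<And>j v. j \<in> J \<Longrightarrow> 0 \<le> v \<Longrightarrow> v < 1 \<Longrightarrow> (\<lambda>k. p j k * v ^ k) sums G j v"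
    and G1: "\<And>j. j \<in> J \<Longrightarrow> G j 1 = 1"
    and gf: "\<And>u. (\<And>j. j \<in> J \<Longrightarrow> 0 \<le> u j \<and> u j \<le> 1) \<Longrightarrow>
        expectation (\<lambda>\<omega>. \<Prod>j\<in>J. count_power (u j) (N j \<omega>)) = (\<Prod>j\<in>J. G j (u j))"
    and K: "K \<subseteq> J"
  shows "prob {\<omega> \<in> space M. \<forall>j\<in>K. N j \<omega> = of_nat (k j)} = (\<Prod>j\<in>K. p j (k j))"
proof -
  define I where "I K \<omega> = (\<Prod>j\<in>K. indicator {of_nat (k j)} (N j \<omega>) :: real)" for K \<omega>
  define C where "C K u \<omega> = (\<Prod>j\<in>J - K. count_power (u j) (N j \<omega>))" for K u \<omega>
  have I_meas: "I K \<in> borel_measurable M" if "K \<subseteq> J" for K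
    unfolding I_def[abs_def]
  proof (rule borel_measurable_prod)
    fix j assume "j \<in> K"
    then have [measurable]: "N j \<in> borel_measurable M" using that by auto
    show "(\<lambda>\<omega>. indicator {of_nat (k j)} (N j \<omega>) :: real) \<in> borel_measurable M"
      by measurable
  qed
  have C_meas: "C K u \<in> borel_measurable M" for K u
    unfolding C_def[abs_def]
  proof (rule borel_measurable_prod)
    fix j assume "j \<in> J - K"
    then have [measurable]: "N j \<in> borel_measurable M" by auto
    show "(\<lambda>\<omega>. count_power (u j) (N j \<omega>)) \<in> borel_measurable M"
      by measurable
  qed
  have I_bd: "0 \<le> I K \<omega> \<and> I K \<omega> \<le> 1" for K \<omega>
    unfolding I_def by (intro conjI prod_unit_interval) (auto simp: indicator_def)
  have C_bd: "0 \<le> C K u \<omega> \<and> C K u \<omega> \<le> 1" if "\<And>j. j \<in> J \<Longrightarrow> 0 \<le> u j \<and> u j \<le> 1" for K u \<omega>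
    unfolding C_def using that
    by (intro conjI prod_unit_interval) (auto simp: count_power_nonneg count_power_le_1)
  have claim: "expectation (\<lambda>\<omega>. I K \<omega> * C K u \<omega>) = (\<Prod>j\<in>K. p j (k j)) * (\<Prod>j\<in>J - K. G j (u j))"
    if "finite K" "K \<subseteq> J" "\<And>j. j \<in> J \<Longrightarrow> 0 \<le> u j \<and> u j \<le> 1" for K u
    using that
  proof (induction K arbitrary: u rule: finite_induct)
    case empty
    then show ?case by (simp add: I_def C_def gf)
  next
    case (insert j K)
    define R where "R = (\<Prod>j\<in>K. p j (k j)) * (\<Prod>j\<in>J - insert j K. G j (u j))"
    define W where "W \<omega> = I K \<omega> * C (insert j K) u \<omega>" for \<omega>
    have jJ: "j \<in> J" "K \<subseteq> J" using insert by auto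
    have split: "J - K = insert j (J - insert j K)"
      using insert jJ by auto
    have W_meas: "W \<in> borel_measurable M"
      unfolding W_def[abs_def] by (intro borel_measurable_times I_meas C_meas jJ)
    have W_bd: "\<bar>W \<omega>\<bar> \<le> 1" for \<omega>
    proof -
      have "0 \<le> C (insert j K) u \<omega> \<and> C (insert j K) u \<omega> \<le> 1"
        by (rule C_bd) (rule insert.prems(2))
      then show ?thesis
        unfolding W_def abs_mult using I_bd[of K \<omega>] by (intro mult_le_one) auto
    qed
    have EW: "expectation (\<lambda>\<omega>. count_power v (N j \<omega>) * W \<omega>) = G j v * R" if v: "0 \<le> v" "v < 1" for v
    proof -
      have u': "0 \<le> (u(j := v)) i \<and> (u(j := v)) i \<le> 1" if "i \<in> J" for i
        using insert.prems(2)[OF that] v by simp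
      have C_eq: "C K (u(j := v)) \<omega> = count_power v (N j \<omega>) * C (insert j K) u \<omega>" for \<omega>
        unfolding C_def split using J by (subst prod.insert) (auto intro!: prod.cong)
      have G_eq: "(\<Prod>i\<in>J - K. G i ((u(j := v)) i)) = G j v * (\<Prod>i\<in>J - insert j K. G i (u i))"
        unfolding split using J by (subst prod.insert) (auto intro!: prod.cong)
      have "expectation (\<lambda>\<omega>. I K \<omega> * C K (u(j := v)) \<omega>)
          = (\<Prod>j\<in>K. p j (k j)) * (\<Prod>i\<in>J - K. G i ((u(j := v)) i))"
        by (rule insert.IH[OF jJ(2)]) (rule u')
      then show ?thesis
        unfolding C_eq G_eq by (simp add: W_def R_def mult_ac)
    qed
    let ?a = "\<lambda>n. expectation (\<lambda>\<omega>. indicator {of_nat n} (N j \<omega>) * W \<omega>)"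
    \<comment> \<open>Both sides are the coefficients of the same power series in the parameter of cell \<open>j\<close>.\<close>
    have "?a = (\<lambda>n. p j n * R)"
    proof (rule power_series_eq_right_imp_eq)
      fix n
      have "\<bar>?a n\<bar> \<le> 1"
      proof -
        have "\<bar>?a n\<bar> \<le> expectation (\<lambda>\<omega>. 1)"
        proof (intro integral_abs_bound[THEN order_trans] integral_mono)
          note [measurable] = W_meas N[OF jJ(1)]
          have "\<bar>indicator {of_nat n} (N j \<omega>) * W \<omega>\<bar> \<le> 1" for \<omega>
            using W_bd[of \<omega>] by (simp add: indicator_def)
          then show "integrable M (\<lambda>\<omega>. \<bar>indicator {of_nat n} (N j \<omega>) * W \<omega>\<bar>)"
            and "\<And>\<omega>. \<bar>indicator {of_nat n} (N j \<omega>) * W \<omega>\<bar> \<le> 1"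
            by (auto intro!: integrable_const_bound[where B=1])
        qed simp
        then show ?thesis by (simp add: prob_space)
      qed
      then show "\<bar>?a n\<bar> \<le> max 1 \<bar>R\<bar>" by simp
      have "\<bar>p j n * R\<bar> \<le> 1 * \<bar>R\<bar>"
        unfolding abs_mult by (intro mult_right_mono p_bd jJ) auto
      then show "\<bar>p j n * R\<bar> \<le> max 1 \<bar>R\<bar>" by simp
    next
      fix v :: real assume v: "0 < v" "v < 1"
      have 1: "(\<lambda>n. ?a n * v ^ n) sums (G j v * R)"
        using expectation_count_power_sums[OF N[OF jJ(1)] N_nat[OF jJ(1)] W_meas W_bd, of v] EW[of v] v
        by simp
      have 2: "(\<lambda>n. p j n * v ^ n * R) sums (G j v * R)"
        by (rule sums_mult2[OF p_sums[OF jJ(1)]]) (use v in auto)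
      show "(\<Sum>n. ?a n * v ^ n) = (\<Sum>n. p j n * R * v ^ n)"
        using sums_unique[OF 1] sums_unique[OF 2] by (simp add: mult_ac)
    qed
    from fun_cong[OF this, of "k j"]
    have "expectation (\<lambda>\<omega>. indicator {of_nat (k j)} (N j \<omega>) * W \<omega>) = p j (k j) * R" .
    moreover have "indicator {of_nat (k j)} (N j \<omega>) * W \<omega> = I (insert j K) \<omega> * C (insert j K) u \<omega>" for \<omega>
      using insert.hyps by (simp add: W_def I_def)
    ultimately show ?case
      using insert.hyps by (simp add: R_def mult.assoc)
  qed
  have finK: "finite K" using J K by (rule finite_subset[rotated])
  have "{\<omega> \<in> space M. \<forall>j\<in>K. N j \<omega> = of_nat (k j)} \<in> events"
  proof (rule sets.sets_Collect_finite_All[OF _ finK])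
    fix j assume "j \<in> K"
    then have [measurable]: "N j \<in> borel_measurable M" using K by auto
    show "{\<omega> \<in> space M. N j \<omega> = of_nat (k j)} \<in> events"
      by measurable
  qed
  then have "prob {\<omega> \<in> space M. \<forall>j\<in>K. N j \<omega> = of_nat (k j)}
      = expectation (indicator {\<omega> \<in> space M. \<forall>j\<in>K. N j \<omega> = of_nat (k j)})"
    by (simp add: Int_absorb2)
  also have "\<dots> = expectation (\<lambda>\<omega>. I K \<omega> * C K (\<lambda>_. 1) \<omega>)"
    using finK by (intro Bochner_Integration.integral_cong)
      (auto simp: I_def C_def indicator_def prod_zero_iff intro!: prod.neutral)
  also have "\<dots> = (\<Prod>j\<in>K. p j (k j))"
    using claim[OF finK K, of "\<lambda>_. 1"] G1 by simp
  finally show ?thesis .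
qed

text \<open>The events \<open>N = k\<close> with finite \<open>k\<close>, the empty and the full event form an intersection-stable system
  generating the sigma-algebra of a count; the event \<open>N = \<infinity>\<close> is the remaining complement.  Regarding
  counts as elements of the countable type of extended naturals makes this generation discrete.\<close>
lemma indep_vars_counts:
  fixes N :: "nat \<Rightarrow> 'a \<Rightarrow> ennreal"
  assumes N: "\<And>j. j < n \<Longrightarrow> N j \<in> borel_measurable M"
    and N_nat: "\<And>j \<omega>. j < n \<Longrightarrow> N j \<omega> \<in> insert \<top> (range of_nat)"
    and joint: "\<And>K k. K \<subseteq> {..<n::nat} \<Longrightarrow>
      prob {\<omega> \<in> space M. \<forall>j\<in>K. N j \<omega> = of_nat (k j)} = (\<Prod>j\<in>K. prob {\<omega> \<in> space M. N j \<omega> = of_nat (k j)})"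
  shows "indep_vars (\<lambda>_. borel) N {..<n}"
proof (cases "n = 0")
  case True
  then show ?thesis by (simp add: indep_vars_def indep_sets_def)
next
  case False
  define T where "T j \<omega> = inv ennreal_of_enat (N j \<omega>)" for j \<omega>
  have inj: "inj ennreal_of_enat" by (simp add: inj_def)
  have NT: "N j \<omega> = ennreal_of_enat (T j \<omega>)" if "j < n" for j \<omega>
  proof -
    have "N j \<omega> \<in> range ennreal_of_enat"
      using N_nat[OF that, of \<omega>]
      by (auto intro: range_eqI[of _ _ \<infinity>] range_eqI[of _ _ "enat _"])
    then show ?thesis by (simp add: T_def f_inv_into_f)
  qed
  have T_meas: "T j \<in> measurable M (count_space UNIV)" if "j < n" for j
  proof (subst measurable_count_space_eq_countable)
    have "T j -` {a} \<inter> space M = {\<omega> \<in> space M. N j \<omega> = ennreal_of_enat a}" for a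
      using NT[OF that] by (auto simp: T_def inj)
    then show "T j \<in> space M \<rightarrow> UNIV \<and> (\<forall>a\<in>UNIV. T j -` {a} \<inter> space M \<in> events)"
      using N[OF that] by simp
  qed simp
  define E where "E = insert UNIV (insert {} (range (\<lambda>k. {enat k})))"
  have E_sigma: "sets (count_space UNIV) = sigma_sets (space (count_space UNIV)) E"
  proof -
    interpret S: sigma_algebra UNIV "sigma_sets UNIV E"
      by (rule sigma_algebra_sigma_sets) simp
    have 1: "{enat k} \<in> sigma_sets UNIV E" for k
      by (auto simp: E_def)
    have "(\<Union>k. {enat k}) \<in> sigma_sets UNIV E"
      using 1 by (intro S.countable_UN) auto
    then have "UNIV - (\<Union>k. {enat k}) \<in> sigma_sets UNIV E"
      by (rule S.compl_sets)
    moreover have "UNIV - (\<Union>k. {enat k}) = {\<infinity>}"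
      using not_infinity_eq by auto
    ultimately have 2: "{a} \<in> sigma_sets UNIV E" for a
      using 1 by (cases a) auto
    have "A \<in> sigma_sets UNIV E" for A
    proof -
      have "(\<Union>a\<in>A. {a}) \<in> sigma_sets UNIV E"
        using 2 by (intro S.countable_UN' countableI_type) auto
      then show ?thesis by simp
    qed
    then show ?thesis by auto
  qed
  have "indep_vars (\<lambda>_. count_space UNIV) T {..<n}"
  proof (subst indep_vars_finite[where E="\<lambda>_. E"])
    show "\<forall>A\<in>(\<Pi> i\<in>{..<n}. E). prob (\<Inter>j\<in>{..<n}. T j -` A j \<inter> space M)
        = (\<Prod>j\<in>{..<n}. prob (T j -` A j \<inter> space M))"
    proof
      fix A assume A: "A \<in> (\<Pi> i\<in>{..<n}. E)"
      show "prob (\<Inter>j\<in>{..<n}. T j -` A j \<inter> space M) = (\<Prod>j\<in>{..<n}. prob (T j -` A j \<inter> space M))"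
      proof (cases "\<exists>j<n. A j = {}")
        case True
        then obtain j where j: "j < n" "A j = {}" by blast
        then have "(\<Inter>j\<in>{..<n}. T j -` A j \<inter> space M) = {}" by blast
        moreover have "(\<Prod>j\<in>{..<n}. prob (T j -` A j \<inter> space M)) = 0"
          using j by (intro prod_zero bexI[of _ j]) auto
        ultimately show ?thesis by simp
      next
        case False
        define K where "K = {j. j < n \<and> A j \<noteq> UNIV}"
        have "\<exists>k. A j = {enat k}" if "j \<in> K" for j
        proof -
          have "A j \<in> E" using A that by (auto simp: K_def)
          then show ?thesis using False that by (auto simp: K_def E_def)
        qed
        then obtain k where k: "\<And>j. j \<in> K \<Longrightarrow> A j = {enat (k j)}" by metis
        have single: "T j -` A j \<inter> space M = {\<omega> \<in> space M. N j \<omega> = of_nat (k j)}" if "j \<in> K" for j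
        proof -
          have "N j \<omega> = of_nat (k j) \<longleftrightarrow> T j \<omega> = enat (k j)" for \<omega>
            using that NT[of j \<omega>] ennreal_of_enat_inj[of "T j \<omega>" "enat (k j)"] by (simp add: K_def)
          then show ?thesis using k[OF that] by auto
        qed
        have full: "T j -` A j \<inter> space M = space M" if "j < n" "j \<notin> K" for j
          using that by (auto simp: K_def)
        have "(\<Inter>j\<in>{..<n}. T j -` A j \<inter> space M) = {\<omega> \<in> space M. \<forall>j\<in>K. N j \<omega> = of_nat (k j)}"
        proof (intro set_eqI iffI)
          fix \<omega> assume *: "\<omega> \<in> (\<Inter>j\<in>{..<n}. T j -` A j \<inter> space M)"
          have "\<omega> \<in> T 0 -` A 0 \<inter> space M" using * \<open>n \<noteq> 0\<close> by blast
          then have "\<omega> \<in> space M" by simp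
          moreover have "N j \<omega> = of_nat (k j)" if "j \<in> K" for j
          proof -
            have "j \<in> {..<n}" using that by (simp add: K_def)
            with * have "\<omega> \<in> T j -` A j \<inter> space M" by blast
            then show ?thesis unfolding single[OF that] by simp
          qed
          ultimately show "\<omega> \<in> {\<omega> \<in> space M. \<forall>j\<in>K. N j \<omega> = of_nat (k j)}" by simp
        next
          fix \<omega> assume *: "\<omega> \<in> {\<omega> \<in> space M. \<forall>j\<in>K. N j \<omega> = of_nat (k j)}"
          have "\<omega> \<in> T j -` A j \<inter> space M" if "j < n" for j
          proof (cases "j \<in> K")
            case True
            then show ?thesis using * by (simp add: single)
          next
            case False
            then show ?thesis using * full[OF that] by simp
          qed
          then show "\<omega> \<in> (\<Inter>j\<in>{..<n}. T j -` A j \<inter> space M)" by blast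
        qed
        also have "prob \<dots> = (\<Prod>j\<in>K. prob {\<omega> \<in> space M. N j \<omega> = of_nat (k j)})"
          by (rule joint) (auto simp: K_def)
        also have "\<dots> = (\<Prod>j\<in>K. prob (T j -` A j \<inter> space M))"
          by (intro prod.cong refl) (simp add: single)
        also have "\<dots> = (\<Prod>j\<in>{..<n}. prob (T j -` A j \<inter> space M))"
          using full by (intro prod.mono_neutral_left) (auto simp: K_def prob_space)
        finally show ?thesis .
      qed
    qed
    show "sets (count_space UNIV) = sigma_sets (space (count_space UNIV)) E"
      by (rule E_sigma)
    show "Int_stable E"
      by (auto simp: Int_stable_def E_def)
  qed (use False T_meas in \<open>auto simp: E_def\<close>)
  then have "indep_vars (\<lambda>_. borel) (\<lambda>j \<omega>. ennreal_of_enat (T j \<omega>)) {..<n}"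
    by (rule indep_vars_compose2) simp
  then show ?thesis
    by (rule indep_vars_cong[THEN iffD1, rotated -1]) (auto simp: NT)
qed

text \<open>Step functions with disjoint cells suffice to recover the joint law of the counts.  The points lie
  in \<open>S\<close> almost surely because the count of its null complement is Poisson with mean \<open>0\<close>.\<close>
lemma poisson_functional_imp_poisson:
  assumes X: "\<And>i. X i \<in> measurable M \<Lambda>" and S: "S \<in> sets \<Lambda>"
    and null: "emeasure \<Lambda> (space \<Lambda> - S) = 0"
    and functional: "\<And>f. f \<in> borel_measurable \<Lambda> \<Longrightarrow> (\<And>x. 0 \<le> f x \<and> f x \<le> 1) \<Longrightarrow> poisson_functional_on M \<Lambda> X f"
  shows "poisson_point_process_on M S \<Lambda> X"
proof -
  have N_meas: "point_count X A \<in> borel_measurable M" if "A \<in> sets \<Lambda>" for A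
    by (rule measurable_point_count[OF X that])
  have N_nat: "point_count X A \<omega> \<in> insert \<top> (range of_nat)" for A \<omega>
    by (simp add: point_count_eq)
  \<comment> \<open>A single term of the exponential series is at most its sum.\<close>
  have weight_bd: "\<bar>poisson_weight l k\<bar> \<le> 1" for l k
  proof -
    have "r ^ k / fact k \<le> exp r" if "r \<ge> 0" for r :: real
    proof -
      have "(\<Sum>i\<in>{k}. r ^ i /\<^sub>R fact i) \<le> (\<Sum>i. r ^ i /\<^sub>R fact i)"
        using that summable_exp_generic[of r] by (intro sum_le_suminf) auto
      then show ?thesis by (simp add: exp_def divide_inverse mult.commute)
    qed
    from mult_left_mono[OF this, of "enn2real l" "exp (- enn2real l)"] show ?thesis
      by (simp add: poisson_weight_def flip: exp_add)
  qed
  have joint: "prob {\<omega> \<in> space M. \<forall>j\<in>K. point_count X (A j) \<omega> = of_nat (k j)}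
      = (\<Prod>j\<in>K. poisson_weight (emeasure \<Lambda> (A j)) (k j))"
    if A: "\<And>j. j < n \<Longrightarrow> A j \<in> sets \<Lambda>" and disj: "disjoint_family_on A {..<n}" and K: "K \<subseteq> {..<n}"
    for n :: nat and A K k
  proof (rule joint_distribution_from_generating_function[where J="{..<n}"
        and G="\<lambda>j v. exp_neg (ennreal (1 - v) * emeasure \<Lambda> (A j))"])
    fix u :: "nat \<Rightarrow> real"
    assume u: "\<And>j. j \<in> {..<n} \<Longrightarrow> 0 \<le> u j \<and> u j \<le> 1"
    let ?f = "\<lambda>x. \<Prod>j<n. if x \<in> A j then u j else 1"
    have f_meas: "?f \<in> borel_measurable \<Lambda>"
      using A by (intro borel_measurable_prod) auto
    have f_bd: "0 \<le> ?f x \<and> ?f x \<le> 1" for x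
      using u by (intro conjI prod_unit_interval) auto
    have 1: "generating_functional M X ?f \<longlonglongrightarrow> exp_neg (\<integral>\<^sup>+x. ennreal (1 - ?f x) \<partial>\<Lambda>)"
      using functional[OF f_meas f_bd] by (simp add: poisson_functional_on_def)
    have 2: "generating_functional M X ?f
        \<longlonglongrightarrow> expectation (\<lambda>\<omega>. \<Prod>j<n. count_power (u j) (point_count X (A j) \<omega>))"
      using A u by (intro generating_functional_step_function[OF X]) auto
    have 3: "(\<integral>\<^sup>+x. ennreal (1 - ?f x) \<partial>\<Lambda>) = (\<Sum>j<n. ennreal (1 - u j) * emeasure \<Lambda> (A j))"
      using A u disj by (intro nn_integral_step_function) auto
    show "expectation (\<lambda>\<omega>. \<Prod>j<n. count_power (u j) (point_count X (A j) \<omega>))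
        = (\<Prod>j<n. exp_neg (ennreal (1 - u j) * emeasure \<Lambda> (A j)))"
      using LIMSEQ_unique[OF 1 2] unfolding 3 by (simp add: exp_neg_sum)
  next
    show "(\<lambda>k. poisson_weight (emeasure \<Lambda> (A j)) k * v ^ k)
        sums exp_neg (ennreal (1 - v) * emeasure \<Lambda> (A j))" if "0 \<le> v" "v < 1" for j v
      using that by (rule poisson_generating_function)
  qed (use A K N_meas N_nat weight_bd in auto)
  have dist: "prob {\<omega> \<in> space M. point_count X A \<omega> = of_nat k} = poisson_weight (emeasure \<Lambda> A) k"
    if "A \<in> sets \<Lambda>" for A k
    using joint[of 1 "\<lambda>_. A" "{0}" "\<lambda>_. k"] that by (simp add: disjoint_family_on_def)
  have "AE \<omega> in M. point_count X (space \<Lambda> - S) \<omega> = of_nat 0"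
  proof -
    have "prob {\<omega> \<in> space M. point_count X (space \<Lambda> - S) \<omega> = of_nat 0} = 1"
      using S by (subst dist) (auto simp: null poisson_weight_def)
    moreover have "{\<omega> \<in> space M. point_count X (space \<Lambda> - S) \<omega> = of_nat 0} \<in> events"
      using N_meas[of "space \<Lambda> - S"] S by measurable
    ultimately show ?thesis
      by (simp add: prob_Collect_eq_1)
  qed
  then have AE_S: "AE \<omega> in M. \<forall>i. X i \<omega> \<in> S"
  proof (rule AE_mp, intro AE_I2 impI allI)
    fix \<omega> i assume \<omega>: "\<omega> \<in> space M" "point_count X (space \<Lambda> - S) \<omega> = of_nat 0"
    then have "{i. X i \<omega> \<in> space \<Lambda> - S} = {}"
      by (auto simp: point_count_eq split: if_splits)
    then show "X i \<omega> \<in> S"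
      using measurable_space[OF X \<omega>(1)] by auto
  qed
  have indep: "indep_vars (\<lambda>_. borel) (\<lambda>j. point_count X (A j)) {..<n}"
    if A: "\<And>j. j < n \<Longrightarrow> A j \<in> sets \<Lambda>" and disj: "disjoint_family_on A {..<n}" for n :: nat and A
  proof (rule indep_vars_counts)
    show "prob {\<omega> \<in> space M. \<forall>j\<in>K. point_count X (A j) \<omega> = of_nat (k j)}
        = (\<Prod>j\<in>K. prob {\<omega> \<in> space M. point_count X (A j) \<omega> = of_nat (k j)})"
      if K: "K \<subseteq> {..<n}" for K k
    proof -
      have "prob {\<omega> \<in> space M. point_count X (A j) \<omega> = of_nat (k j)}
          = poisson_weight (emeasure \<Lambda> (A j)) (k j)" if "j \<in> K" for j
        using that K A by (intro dist) auto
      then show ?thesis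
        using joint[OF A disj K, of k] by simp
    qed
  qed (use A N_meas N_nat in auto)
  show ?thesis
    unfolding poisson_point_process_on_def
  proof (intro conjI ballI allI impI)
    show "prob {\<omega> \<in> space M. point_count X A \<omega> = of_nat k}
        = (if emeasure \<Lambda> A = \<infinity> then 0 else exp (- measure \<Lambda> A) * measure \<Lambda> A ^ k / fact k)"
      if "A \<in> sets \<Lambda>" for A k
      unfolding dist[OF that] by (simp add: poisson_weight_def measure_def)
    show "indep_vars (\<lambda>_. borel) (\<lambda>j. point_count X (A j)) {..<n}"
      if "(\<forall>j<n. A j \<in> sets \<Lambda> \<and> A j \<subseteq> S) \<and> disjoint_family_on A {..<n}" for n :: nat and A
      using that by (intro indep) auto
  qed (use X S AE_S in auto)
qed

end

section \<open>Independent marking and mapping\<close>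

context prob_space
begin

lemma distr_indep_rvs:
  assumes "indep_rvs M S X T Y"
  shows "distr M (S \<Otimes>\<^sub>M T) (\<lambda>\<omega>. (X \<omega>, Y \<omega>)) = distr M S X \<Otimes>\<^sub>M distr M T Y"
proof -
  have X [measurable]: "X \<in> measurable M S" and Y [measurable]: "Y \<in> measurable M T"
    and indep: "indep_set (sets (vimage_algebra (space M) X S)) (sets (vimage_algebra (space M) Y T))"
    using assms by (auto simp: indep_rvs_def)
  interpret PX: prob_space "distr M S X" by (rule prob_space_distr) (rule X)
  interpret PY: prob_space "distr M T Y" by (rule prob_space_distr) (rule Y)
  show ?thesis
  proof (rule pair_measure_eqI[symmetric])
    fix A B assume "A \<in> sets (distr M S X)" "B \<in> sets (distr M T Y)"
    then have AB [measurable]: "A \<in> sets S" "B \<in> sets T" by auto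
    have "prob ((X -` A \<inter> space M) \<inter> (Y -` B \<inter> space M))
        = prob (X -` A \<inter> space M) * prob (Y -` B \<inter> space M)"
      using AB by (intro indep_setD[OF indep] in_vimage_algebra)
    moreover have "(\<lambda>\<omega>. (X \<omega>, Y \<omega>)) -` (A \<times> B) \<inter> space M
        = (X -` A \<inter> space M) \<inter> (Y -` B \<inter> space M)"
      by auto
    ultimately show "emeasure (distr M S X) A * emeasure (distr M T Y) B
        = emeasure (distr M (S \<Otimes>\<^sub>M T) (\<lambda>\<omega>. (X \<omega>, Y \<omega>))) (A \<times> B)"
      by (simp add: emeasure_distr emeasure_eq_measure ennreal_mult)
  qed (auto intro: PX.sigma_finite_measure PY.sigma_finite_measure sets_pair_measure_cong
        PX.sigma_finite_measure_axioms PY.sigma_finite_measure_axioms)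
qed

text \<open>Sampling the second argument from its own copy \<open>\<omega>'\<close> of the probability space lets the
  independence of the marks be applied for a fixed configuration of points.\<close>
lemma expectation_indep_rvs:
  fixes F :: "'b \<times> 'c \<Rightarrow> real"
  assumes indep: "indep_rvs M S X T Y"
    and F [measurable]: "F \<in> borel_measurable (S \<Otimes>\<^sub>M T)" and F_bd: "\<And>p. \<bar>F p\<bar> \<le> 1"
  shows "expectation (\<lambda>\<omega>. F (X \<omega>, Y \<omega>)) = expectation (\<lambda>\<omega>'. expectation (\<lambda>\<omega>. F (X \<omega>, Y \<omega>')))"
proof -
  have X [measurable]: "X \<in> measurable M S" and Y [measurable]: "Y \<in> measurable M T"
    using indep by (auto simp: indep_rvs_def)
  interpret PX: prob_space "distr M S X" by (rule prob_space_distr) (rule X)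
  interpret PY: prob_space "distr M T Y" by (rule prob_space_distr) (rule Y)
  interpret PXY: pair_prob_space "distr M S X" "distr M T Y" ..
  have int: "integrable (distr M S X \<Otimes>\<^sub>M distr M T Y) (\<lambda>(x, y). F (x, y))"
    using F_bd by (intro PXY.P.integrable_const_bound[where B=1]) auto
  have "expectation (\<lambda>\<omega>. F (X \<omega>, Y \<omega>)) = integral\<^sup>L (distr M (S \<Otimes>\<^sub>M T) (\<lambda>\<omega>. (X \<omega>, Y \<omega>))) F"
    by (subst integral_distr) auto
  also have "\<dots> = (\<integral>y. \<integral>x. F (x, y) \<partial>distr M S X \<partial>distr M T Y)"
    using PXY.integral_snd[OF int] by (simp add: distr_indep_rvs[OF indep])
  also have "\<dots> = (\<integral>y. (\<integral>\<omega>. F (X \<omega>, y) \<partial>M) \<partial>distr M T Y)"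
  proof (rule Bochner_Integration.integral_cong[OF refl])
    fix y assume "y \<in> space (distr M T Y)"
    then have [measurable]: "(\<lambda>x. F (x, y)) \<in> borel_measurable S"
      by (intro measurable_compose[OF _ F]) (auto intro!: measurable_Pair)
    show "(\<integral>x. F (x, y) \<partial>distr M S X) = (\<integral>\<omega>. F (X \<omega>, y) \<partial>M)"
      by (subst integral_distr) auto
  qed
  also have "\<dots> = expectation (\<lambda>\<omega>'. expectation (\<lambda>\<omega>. F (X \<omega>, Y \<omega>')))"
  proof (rule integral_distr[OF Y])
    have "(\<lambda>(y, \<omega>). F (X \<omega>, y)) \<in> borel_measurable (T \<Otimes>\<^sub>M M)"
      by measurable
    then show "(\<lambda>y. \<integral>\<omega>. F (X \<omega>, y) \<partial>M) \<in> borel_measurable T"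
      by (rule borel_measurable_lebesgue_integral)
  qed
  finally show ?thesis .
qed

text \<open>Conditionally on the points, the marks are independent, so each point may be given the average of
  its factor over the mark.\<close>
lemma generating_functional_marked:
  fixes \<psi> :: "'b \<times> 'c \<Rightarrow> real"
  assumes marks: "indep_vars (\<lambda>_. N) h UNIV" and copies: "\<And>i::nat. distr M N (h i) = \<mu>"
    and indep: "indep_rvs M (PiM UNIV (\<lambda>_. N)) (\<lambda>\<omega> i. h i \<omega>) (PiM UNIV (\<lambda>_. K)) (\<lambda>\<omega> i. y i \<omega>)"
    and y: "\<And>i. y i \<in> measurable M K"
    and \<psi> [measurable]: "\<psi> \<in> borel_measurable (K \<Otimes>\<^sub>M N)" and \<psi>01: "\<And>p. 0 \<le> \<psi> p \<and> \<psi> p \<le> 1"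
  shows "generating_functional M (\<lambda>i \<omega>. (y i \<omega>, h i \<omega>)) \<psi> m
           = generating_functional M y (\<lambda>z. \<integral>t. \<psi> (z, t) \<partial>\<mu>) m"
proof -
  have h [measurable]: "h i \<in> measurable M N" for i
    using marks by (auto simp: indep_vars_def)
  have [measurable_cong]: "sets \<mu> = sets N"
    by (simp flip: copies[of 0])
  define F where "F = (\<lambda>(s, z). \<Prod>i<m. \<psi> (z i, s i))"
  have F_meas: "F \<in> borel_measurable (PiM UNIV (\<lambda>_. N) \<Otimes>\<^sub>M PiM UNIV (\<lambda>_. K))"
    unfolding F_def by measurable
  have F_bd: "\<bar>F p\<bar> \<le> 1" for p
    using prod_unit_interval[of "{..<m}" "\<lambda>i. \<psi> (snd p i, fst p i)"] \<psi>01
    by (simp add: F_def case_prod_beta)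
  have "generating_functional M (\<lambda>i \<omega>. (y i \<omega>, h i \<omega>)) \<psi> m
      = expectation (\<lambda>\<omega>. F (\<lambda>i. h i \<omega>, \<lambda>i. y i \<omega>))"
    by (simp add: generating_functional_def F_def)
  also have "\<dots> = expectation (\<lambda>\<omega>'. expectation (\<lambda>\<omega>. F (\<lambda>i. h i \<omega>, \<lambda>i. y i \<omega>')))"
    by (rule expectation_indep_rvs[OF indep F_meas F_bd])
  also have "\<dots> = expectation (\<lambda>\<omega>'. \<Prod>i<m. \<integral>t. \<psi> (y i \<omega>', t) \<partial>\<mu>)"
  proof (rule Bochner_Integration.integral_cong[OF refl])
    fix \<omega>' assume "\<omega>' \<in> space M"
    then have y_sp: "y i \<omega>' \<in> space K" for i
      by (rule measurable_space[OF y])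
    have \<psi>_y [measurable]: "(\<lambda>t. \<psi> (y i \<omega>', t)) \<in> borel_measurable N" for i
      by (rule measurable_compose[OF measurable_Pair1'[OF y_sp] \<psi>])
    have "expectation (\<lambda>\<omega>. F (\<lambda>i. h i \<omega>, \<lambda>i. y i \<omega>')) = expectation (\<lambda>\<omega>. \<Prod>i<m. \<psi> (y i \<omega>', h i \<omega>))"
      by (simp add: F_def)
    also have "\<dots> = (\<Prod>i<m. expectation (\<lambda>\<omega>. \<psi> (y i \<omega>', h i \<omega>)))"
    proof (rule indep_vars_lebesgue_integral)
      have "indep_vars (\<lambda>_. N) h {..<m}"
        by (rule indep_vars_subset[OF marks]) simp
      then show "indep_vars (\<lambda>_. borel) (\<lambda>i \<omega>. \<psi> (y i \<omega>', h i \<omega>)) {..<m}"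
        by (rule indep_vars_compose2) (rule \<psi>_y)
      show "integrable M (\<lambda>\<omega>. \<psi> (y i \<omega>', h i \<omega>))" for i
        using \<psi>01 by (intro integrable_const_bound[where B=1]) auto
    qed simp
    also have "\<dots> = (\<Prod>i<m. \<integral>t. \<psi> (y i \<omega>', t) \<partial>\<mu>)"
      by (intro prod.cong refl) (subst copies[symmetric], subst integral_distr, auto)
    finally show "expectation (\<lambda>\<omega>. F (\<lambda>i. h i \<omega>, \<lambda>i. y i \<omega>')) = (\<Prod>i<m. \<integral>t. \<psi> (y i \<omega>', t) \<partial>\<mu>)" .
  qed
  finally show ?thesis
    by (simp add: generating_functional_def)
qed

text \<open>The marking and mapping theorems in one: attach independent marks of law \<open>\<mu>\<close> to a Poisson process
  with intensity \<open>K\<close> and move the marked points by \<open>G\<close>; the result is Poisson, with the image of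
  \<open>K \<Otimes> \<mu>\<close> as intensity.  Averaging \<open>f \<circ> G\<close> over the mark gives a test function \<open>g\<close> for the original
  process, and \<open>\<integral>(1 - g) dK = \<integral>(1 - f \<circ> G) d(K \<Otimes> \<mu>)\<close> by Tonelli.\<close>
theorem poisson_marking_mapping:
  assumes ppp: "poisson_point_process_on M (space K) K y"
    and marks: "indep_vars (\<lambda>_. N) h UNIV" and copies: "\<And>i::nat. distr M N (h i) = \<mu>"
    and indep: "indep_rvs M (PiM UNIV (\<lambda>_. N)) (\<lambda>\<omega> i. h i \<omega>) (PiM UNIV (\<lambda>_. K)) (\<lambda>\<omega> i. y i \<omega>)"
    and G [measurable]: "G \<in> measurable (K \<Otimes>\<^sub>M N) \<Xi>"
    and S: "S \<in> sets \<Xi>" and null: "emeasure (distr (K \<Otimes>\<^sub>M \<mu>) \<Xi> G) (space \<Xi> - S) = 0"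
  shows "poisson_point_process_on M S (distr (K \<Otimes>\<^sub>M \<mu>) \<Xi> G) (\<lambda>i \<omega>. G (y i \<omega>, h i \<omega>))"
proof (rule poisson_functional_imp_poisson)
  have y [measurable]: "y i \<in> measurable M K" for i
    using ppp by (simp add: poisson_point_process_on_def)
  have h [measurable]: "h i \<in> measurable M N" for i
    using marks by (auto simp: indep_vars_def)
  have [measurable_cong]: "sets \<mu> = sets N"
    by (simp flip: copies[of 0])
  interpret \<mu>: prob_space \<mu>
    unfolding copies[of 0, symmetric] by (rule prob_space_distr) (rule h)
  show "(\<lambda>\<omega>. G (y i \<omega>, h i \<omega>)) \<in> measurable M (distr (K \<Otimes>\<^sub>M \<mu>) \<Xi> G)" for i
    by measurable
  fix f :: "'d \<Rightarrow> real"
  assume "f \<in> borel_measurable (distr (K \<Otimes>\<^sub>M \<mu>) \<Xi> G)" and f01: "\<And>x. 0 \<le> f x \<and> f x \<le> 1"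
  then have f [measurable]: "f \<in> borel_measurable \<Xi>" by simp
  define g where "g z = (\<integral>t. f (G (z, t)) \<partial>\<mu>)" for z
  have g_meas: "g \<in> borel_measurable K"
    unfolding g_def by measurable
  have int: "integrable \<mu> (\<lambda>t. f (G (z, t)))" if "z \<in> space K" for z
    using that f01 by (intro \<mu>.integrable_const_bound[where B=1]) auto
  have g01: "0 \<le> g z \<and> g z \<le> 1" for z
  proof (cases "integrable \<mu> (\<lambda>t. f (G (z, t)))")
    case True
    then show ?thesis
      using f01 integral_mono[OF True, of "\<lambda>_. 1"] unfolding g_def
      by (auto intro!: integral_nonneg_AE simp: \<mu>.prob_space)
  next
    case False
    then show ?thesis by (simp add: g_def not_integrable_integral_eq)
  qed
  have "poisson_functional_on M K y g"
    by (rule poisson_imp_functional[OF ppp g_meas g01])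
  moreover have "generating_functional M y g = generating_functional M (\<lambda>i \<omega>. G (y i \<omega>, h i \<omega>)) f"
  proof
    fix m
    show "generating_functional M y g m = generating_functional M (\<lambda>i \<omega>. G (y i \<omega>, h i \<omega>)) f m"
      using generating_functional_marked[OF marks copies indep y, of "\<lambda>p. f (G p)" m] f01
      by (simp add: g_def[abs_def] generating_functional_def)
  qed
  moreover have "(\<integral>\<^sup>+z. ennreal (1 - g z) \<partial>K) = (\<integral>\<^sup>+x. ennreal (1 - f x) \<partial>distr (K \<Otimes>\<^sub>M \<mu>) \<Xi> G)"
  proof -
    have "(\<integral>\<^sup>+z. ennreal (1 - g z) \<partial>K) = (\<integral>\<^sup>+z. \<integral>\<^sup>+t. ennreal (1 - f (G (z, t))) \<partial>\<mu> \<partial>K)"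
    proof (rule nn_integral_cong)
      fix z assume z: "z \<in> space K"
      have "(\<integral>\<^sup>+t. ennreal (1 - f (G (z, t))) \<partial>\<mu>) = ennreal (\<integral>t. 1 - f (G (z, t)) \<partial>\<mu>)"
        using f01 int[OF z] by (intro nn_integral_eq_integral) auto
      then show "ennreal (1 - g z) = (\<integral>\<^sup>+t. ennreal (1 - f (G (z, t))) \<partial>\<mu>)"
        using int[OF z] by (simp add: g_def \<mu>.prob_space)
    qed
    also have "\<dots> = (\<integral>\<^sup>+p. ennreal (1 - f (G p)) \<partial>(K \<Otimes>\<^sub>M \<mu>))"
      by (rule \<mu>.nn_integral_fst) measurable
    also have "\<dots> = (\<integral>\<^sup>+x. ennreal (1 - f x) \<partial>distr (K \<Otimes>\<^sub>M \<mu>) \<Xi> G)"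
      by (subst nn_integral_distr) auto
    finally show ?thesis .
  qed
  ultimately show "poisson_functional_on M (distr (K \<Otimes>\<^sub>M \<mu>) \<Xi> G) (\<lambda>i \<omega>. G (y i \<omega>, h i \<omega>)) f"
    by (simp add: poisson_functional_on_def)
qed (use S null in auto)

end

section \<open>Densities as derivatives of distribution functions\<close>

lemma AE_right_derivative_indefinite_integral:
  fixes f :: "real \<Rightarrow> real"
  assumes f: "\<And>a b. f integrable_on {a..b}"
  obtains N where "negligible N"
    "\<And>x. x \<notin> N \<Longrightarrow> ((\<lambda>h. integral {x..x + h} f / h) \<longlongrightarrow> f x) (at_right 0)"
proof -
  obtain N where N: "negligible N"
    "\<And>x e. \<lbrakk>x \<notin> N; 0 < e\<rbrakk> \<Longrightarrow> \<exists>d>0. \<forall>h. 0 < h \<and> h < d \<longrightarrow>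
        norm (integral (cbox x (x + h *\<^sub>R One)) f /\<^sub>R h ^ DIM(real) - f x) < e"
    using integrable_ccontinuous_explicit[of f] f by (auto simp: cbox_interval)
  show ?thesis
  proof (rule that[OF N(1)])
    fix x assume x: "x \<notin> N"
    show "((\<lambda>h. integral {x..x + h} f / h) \<longlongrightarrow> f x) (at_right 0)"
    proof (rule tendstoI)
      fix e :: real assume "0 < e"
      from N(2)[OF x this] obtain d where "d > 0"
        "\<And>h. 0 < h \<Longrightarrow> h < d \<Longrightarrow> norm (integral (cbox x (x + h *\<^sub>R One)) f /\<^sub>R h ^ DIM(real) - f x) < e"
        by blast
      then show "eventually (\<lambda>h. dist (integral {x..x + h} f / h) (f x) < e) (at_right 0)"
        unfolding eventually_at_right_field
        by (intro exI[of _ d]) (auto simp: dist_norm divide_inverse mult.commute)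
    qed
  qed
qed

text \<open>Right difference quotients converge almost everywhere; left ones are right difference quotients of
  the reflected function.\<close>
lemma AE_has_derivative_indefinite_integral:
  fixes f F :: "real \<Rightarrow> real"
  assumes f: "\<And>a b. f integrable_on {a..b}"
    and F: "\<And>a b. a \<le> b \<Longrightarrow> F b - F a = integral {a..b} f"
  shows "AE x in lborel. (F has_real_derivative f x) (at x)"
proof -
  have f': "(\<lambda>x. f (- x)) integrable_on {a..b}" for a b
    using f[of "- b" "- a"] Henstock_Kurzweil_Integration.integrable_reflect_real[of f "- a" "- b"] by simp
  obtain N where N: "negligible N"
    "\<And>x. x \<notin> N \<Longrightarrow> ((\<lambda>h. integral {x..x + h} f / h) \<longlongrightarrow> f x) (at_right 0)"
    using AE_right_derivative_indefinite_integral[OF f] by blast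
  obtain N' where N': "negligible N'"
    "\<And>x. x \<notin> N' \<Longrightarrow> ((\<lambda>h. integral {x..x + h} (\<lambda>x. f (- x)) / h) \<longlongrightarrow> f (- x)) (at_right 0)"
    using AE_right_derivative_indefinite_integral[OF f'] by blast
  have deriv: "(F has_real_derivative f x) (at x)" if x: "x \<notin> N" "- x \<notin> N'" for x
    unfolding DERIV_def
  proof (rule filterlim_split_at)
    have "((\<lambda>h. integral {x..x + h} f / h) \<longlongrightarrow> f x) (at_right 0)"
      by (rule N(2)[OF x(1)])
    moreover have "eventually (\<lambda>h. integral {x..x + h} f / h = (F (x + h) - F x) / h) (at_right 0)"
      by (auto simp: F eventually_at_right_field intro!: exI[of _ 1])
    ultimately show "((\<lambda>h. (F (x + h) - F x) / h) \<longlongrightarrow> f x) (at_right 0)"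
      by (rule Lim_transform_eventually)
  next
    have "((\<lambda>h. integral {- x..- x + h} (\<lambda>x. f (- x)) / h) \<longlongrightarrow> f x) (at_right 0)"
      using N'(2)[OF x(2)] by simp
    moreover have "eventually (\<lambda>h. integral {- x..- x + h} (\<lambda>x. f (- x)) / h = (F (x + - h) - F x) / - h) (at_right 0)"
    proof -
      have "integral {- x..- x + h} (\<lambda>x. f (- x)) = F x - F (x - h)" if "h > 0" for h
        using F[of "x - h" x] Henstock_Kurzweil_Integration.integral_reflect_real[where f=f and b=x and a="x - h"] that
        by (simp add: add.commute)
      then show ?thesis
        by (auto simp: eventually_at_right_field field_simps intro!: exI[of _ 1])
    qed
    ultimately have "((\<lambda>h. (F (x + - h) - F x) / - h) \<longlongrightarrow> f x) (at_right 0)"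
      by (rule Lim_transform_eventually)
    then show "((\<lambda>h. (F (x + h) - F x) / h) \<longlongrightarrow> f x) (at_left 0)"
      by (subst filterlim_at_left_to_right) (simp only: add_0 minus_zero)
  qed
  have "negligible (N \<union> uminus ` N')"
    using N(1) N'(1)
    by (intro negligible_Un negligible_differentiable_image_negligible) (auto intro: derivative_intros)
  then have "AE x in lebesgue. x \<notin> N \<union> uminus ` N'"
    unfolding negligible_iff_null_sets by (rule AE_not_in)
  then have "AE x in lborel. x \<notin> N \<union> uminus ` N'"
    by (simp add: AE_completion_iff)
  then show ?thesis
  proof (rule AE_mp, intro AE_I2 impI)
    fix x assume "x \<notin> N \<union> uminus ` N'"
    then show "(F has_real_derivative f x) (at x)"
      by (intro deriv) (auto intro: image_eqI[of _ _ "- x"])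
  qed
qed

text \<open>The derivative of the distribution function is a version of the Radon-Nikodym density.  At points
  where \<open>F\<close> is not differentiable, \<open>deriv F\<close> is an unspecified value, but these points form a null set,
  and the measure with a given density depends only on the almost-everywhere class of that density.\<close>
lemma absolutely_continuous_eq_density_deriv:
  fixes F :: "real \<Rightarrow> real"
  assumes sets [measurable_cong]: "sets \<nu> = sets borel" and ac: "absolutely_continuous lborel \<nu>"
    and F: "\<And>t. emeasure \<nu> {..t} = ennreal (F t)" and F_nonneg: "\<And>t. 0 \<le> F t"
  shows "continuous_on UNIV F"
    and "density lborel (\<lambda>t. ennreal (c * deriv F t)) = density \<nu> (\<lambda>_. ennreal c)"
proof -
  have "sets \<nu> = sets lborel"
    using sets by simp
  with ac obtain b where b [measurable]: "b \<in> borel_measurable lborel" and \<nu>_b: "density lborel b = \<nu>"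
    using sigma_finite_measure.Radon_Nikodym[OF sigma_finite_lborel] by blast
  have b_fin: "(\<integral>\<^sup>+x. b x * indicator {..t} x \<partial>lborel) = ennreal (F t)" for t
    using F[of t] unfolding \<nu>_b[symmetric] by (subst (asm) emeasure_density) auto
  have "AE x in lborel. b x \<noteq> \<infinity>"
  proof -
    have "AE x in lborel. x \<le> real n \<longrightarrow> b x \<noteq> \<infinity>" for n
    proof -
      have "AE x in lborel. b x * indicator {..real n} x \<noteq> \<infinity>"
        by (rule nn_integral_PInf_AE) (use b_fin[of n] in auto)
      then show ?thesis
        by eventually_elim (auto simp: indicator_def)
    qed
    then have "AE x in lborel. \<forall>n. x \<le> real n \<longrightarrow> b x \<noteq> \<infinity>"
      by (subst AE_all_countable) blast
    then show ?thesis
      by eventually_elim (use real_arch_simple in blast)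
  qed
  then have b_real: "AE x in lborel. b x = ennreal (enn2real (b x))"
    by eventually_elim (simp add: less_top)
  define f where "f x = enn2real (b x)" for x
  have f_meas [measurable]: "f \<in> borel_measurable borel"
    unfolding f_def using b by measurable
  have f_nonneg: "0 \<le> f x" for x by (simp add: f_def)
  have b_f: "(\<integral>\<^sup>+x. b x * g x \<partial>lborel) = (\<integral>\<^sup>+x. ennreal (f x) * g x \<partial>lborel)" for g
    by (rule nn_integral_cong_AE) (use b_real in eventually_elim, simp add: f_def)
  have f_fin: "(\<integral>\<^sup>+x. ennreal (f x) * indicator {..t} x \<partial>lborel) = ennreal (F t)" for t
    using b_fin by (simp add: b_f)
  have ind: "(f has_integral (F t - F s)) {s..t}" if st: "s \<le> t" for s t
  proof -
    have "(\<integral>\<^sup>+x. ennreal (f x) * indicator {..t} x \<partial>lborel)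
        = (\<integral>\<^sup>+x. ennreal (f x) * indicator {..s} x + ennreal (f x) * indicator {s<..t} x \<partial>lborel)"
      using st by (intro nn_integral_cong) (auto simp: indicator_def)
    also have "\<dots> = (\<integral>\<^sup>+x. ennreal (f x) * indicator {..s} x \<partial>lborel)
        + (\<integral>\<^sup>+x. ennreal (f x) * indicator {s<..t} x \<partial>lborel)"
      by (rule nn_integral_add) auto
    finally have eq: "ennreal (F t) = ennreal (F s) + (\<integral>\<^sup>+x. ennreal (f x) * indicator {s<..t} x \<partial>lborel)"
      by (simp add: f_fin)
    have "(\<integral>\<^sup>+x. ennreal (f x) * indicator {s<..t} x \<partial>lborel) = ennreal (F t - F s)"
      using arg_cong[OF eq, of "\<lambda>x. x - ennreal (F s)"] F_nonneg by (simp add: ennreal_minus)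
    moreover have "F s \<le> F t"
    proof -
      have "ennreal (F s) \<le> ennreal (F t)" unfolding eq by simp
      then show ?thesis using F_nonneg[of t] by (simp add: ennreal_le_iff)
    qed
    moreover have "(\<integral>\<^sup>+x. ennreal (f x) * indicator {s<..t} x \<partial>lborel)
        = (\<integral>\<^sup>+x. ennreal (if x \<in> {s..t} then f x else 0) \<partial>lborel)"
      using AE_lborel_singleton[of s]
      by (intro nn_integral_cong_AE) (auto elim!: eventually_mono simp: indicator_def)
    ultimately have "((\<lambda>x. if x \<in> {s..t} then f x else 0) has_integral (F t - F s)) UNIV"
      using f_nonneg by (intro nn_integral_has_integral) auto
    then show ?thesis
      by (simp only: has_integral_restrict_UNIV)
  qed
  have f_int: "f integrable_on {s..t}" for s t
    using ind[of s t] by (cases "s \<le> t") (auto simp: integrable_on_def)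
  have F_diff: "F t - F s = integral {s..t} f" if "s \<le> t" for s t
    using ind[OF that] by (simp add: integral_unique)
  show "continuous_on UNIV F"
  proof (subst continuous_on_eq_continuous_at, simp, intro ballI)
    fix x :: real
    have "continuous_on {x - 1..x + 1} (\<lambda>t. F (x - 1) + integral {x - 1..t} f)"
      by (intro continuous_intros indefinite_integral_continuous_1 f_int)
    then have "continuous_on {x - 1..x + 1} F"
      by (rule continuous_on_eq) (simp flip: F_diff)
    then show "isCont F x"
      by (rule continuous_on_interior) simp
  qed
  have deriv_F: "AE t in lborel. (F has_real_derivative f t) (at t)"
    by (rule AE_has_derivative_indefinite_integral[OF f_int F_diff])
  have "density \<nu> (\<lambda>_. ennreal c) = density lborel (\<lambda>t. b t * ennreal c)"
    unfolding \<nu>_b[symmetric] by (rule density_density_eq) auto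
  also have "\<dots> = density lborel (\<lambda>t. ennreal (c * deriv F t))"
    unfolding density_def
  proof (intro arg_cong2[where f="measure_of (space lborel)"] refl ext nn_integral_cong_AE)
    fix A
    show "AE t in lborel. b t * ennreal c * indicator A t = ennreal (c * deriv F t) * indicator A t"
      using deriv_F b_real
      by eventually_elim (simp add: DERIV_imp_deriv f_def mult.commute ennreal_mult'')
  qed
  finally show "density lborel (\<lambda>t. ennreal (c * deriv F t)) = density \<nu> (\<lambda>_. ennreal c)" ..
qed

section \<open>Path loss with fading\<close>

text \<open>The intensity of the path losses \<open>1 / (t L(z))\<close> when \<open>z\<close> ranges over points of unit intensity and
  \<open>t\<close> is an independent mark of law \<open>\<mu>\<close>.\<close>
definition loss_measure :: "('a::euclidean_space \<Rightarrow> real) \<Rightarrow> real measure \<Rightarrow> real measure" where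
  "loss_measure L \<mu> = distr (lborel \<Otimes>\<^sub>M \<mu>) borel (\<lambda>(z, t). inverse (t * L z))"

locale fading_law = prob_space \<mu> for \<mu> :: "real measure" +
  assumes sets_\<mu> [measurable_cong]: "sets \<mu> = sets borel"
    and ac: "absolutely_continuous lborel \<mu>"
    and pos: "AE t in \<mu>. 0 < t"
begin

lemma space_\<mu> [simp]: "space \<mu> = UNIV"
  using sets_eq_imp_space_eq[OF sets_\<mu>] by simp

lemma emeasure_distr_loss:
  assumes K: "sets K = sets borel" and L [measurable]: "L \<in> borel_measurable borel"
    and A [measurable]: "A \<in> sets borel"
  shows "emeasure (distr (K \<Otimes>\<^sub>M \<mu>) borel (\<lambda>(z, t). inverse (t * L z))) A
           = (\<integral>\<^sup>+z. emeasure \<mu> {t. inverse (t * L z) \<in> A} \<partial>K)"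
proof -
  note [measurable_cong] = K
  have "emeasure (distr (K \<Otimes>\<^sub>M \<mu>) borel (\<lambda>(z, t). inverse (t * L z))) A
      = emeasure (K \<Otimes>\<^sub>M \<mu>) ((\<lambda>(z, t). inverse (t * L z)) -` A \<inter> space (K \<Otimes>\<^sub>M \<mu>))"
    by (rule emeasure_distr) measurable
  also have "\<dots> = (\<integral>\<^sup>+z. emeasure \<mu> (Pair z -` ((\<lambda>(z, t). inverse (t * L z)) -` A \<inter> space (K \<Otimes>\<^sub>M \<mu>))) \<partial>K)"
    by (rule emeasure_pair_measure_alt) measurable
  also have "\<dots> = (\<integral>\<^sup>+z. emeasure \<mu> {t. inverse (t * L z) \<in> A} \<partial>K)"
    by (intro nn_integral_cong arg_cong[where f="emeasure \<mu>"]) (auto simp: space_pair_measure)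
  finally show ?thesis .
qed

lemma sets_loss_measure [simp, measurable_cong]: "sets (loss_measure L \<mu>) = sets borel"
  by (simp add: loss_measure_def)

lemma emeasure_loss_measure:
  assumes "L \<in> borel_measurable borel" "A \<in> sets borel"
  shows "emeasure (loss_measure L \<mu>) A = (\<integral>\<^sup>+z. emeasure \<mu> {t. inverse (t * L z) \<in> A} \<partial>lborel)"
  unfolding loss_measure_def by (rule emeasure_distr_loss) (use assms in auto)

lemma measurable_emeasure_loss:
  assumes L [measurable]: "L \<in> borel_measurable borel" and A [measurable]: "A \<in> sets borel"
  shows "(\<lambda>z. emeasure \<mu> {t. inverse (t * L z) \<in> A}) \<in> borel_measurable borel"
proof -
  have "{p \<in> space (borel \<Otimes>\<^sub>M \<mu>). inverse (snd p * L (fst p)) \<in> A} \<in> sets (borel \<Otimes>\<^sub>M \<mu>)"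
    by measurable
  from measurable_emeasure_Pair[OF this] show ?thesis
    by (simp add: space_pair_measure vimage_def)
qed

text \<open>The observation point \<open>x\<close> drops out by translation invariance of Lebesgue measure.\<close>
lemma distr_loss_translate:
  assumes L [measurable]: "L \<in> borel_measurable borel"
  shows "distr (density lborel (\<lambda>_. ennreal c) \<Otimes>\<^sub>M \<mu>) borel (\<lambda>(z, t). inverse (t * L (z - x)))
           = density (loss_measure L \<mu>) (\<lambda>_. ennreal c)"
proof (rule measure_eqI)
  fix A assume "A \<in> sets (distr (density lborel (\<lambda>_. ennreal c) \<Otimes>\<^sub>M \<mu>) borel (\<lambda>(z, t). inverse (t * L (z - x))))"
  then have A [measurable]: "A \<in> sets borel" by simp
  let ?q = "\<lambda>z. emeasure \<mu> {t. inverse (t * L z) \<in> A}"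
  have q_meas [measurable]: "?q \<in> borel_measurable borel"
    by (rule measurable_emeasure_loss) measurable
  have "emeasure (distr (density lborel (\<lambda>_. ennreal c) \<Otimes>\<^sub>M \<mu>) borel (\<lambda>(z, t). inverse (t * L (z - x)))) A
      = (\<integral>\<^sup>+z. ?q (z - x) \<partial>density lborel (\<lambda>_. ennreal c))"
    by (rule emeasure_distr_loss) auto
  also have "\<dots> = ennreal c * (\<integral>\<^sup>+z. ?q (z - x) \<partial>lborel)"
    by (subst nn_integral_density) (auto intro!: nn_integral_cmult)
  also have "(\<integral>\<^sup>+z. ?q (z - x) \<partial>lborel) = (\<integral>\<^sup>+z. ?q z \<partial>distr lborel borel ((+) (- x)))"
    by (subst nn_integral_distr) auto
  also have "\<dots> = emeasure (loss_measure L \<mu>) A"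
    by (simp add: lborel_distr_plus emeasure_loss_measure)
  finally show "emeasure (distr (density lborel (\<lambda>_. ennreal c) \<Otimes>\<^sub>M \<mu>) borel (\<lambda>(z, t). inverse (t * L (z - x)))) A
      = emeasure (density (loss_measure L \<mu>) (\<lambda>_. ennreal c)) A"
    by (simp add: emeasure_density_const)
qed simp

text \<open>For fixed \<open>c > 0\<close> the map \<open>t \<mapsto> 1 / (t c)\<close> is a smooth involution of the nonzero reals: up to \<open>t = 0\<close>,
  the marks sent into a null set \<open>A\<close> form the image of \<open>A\<close> under the same map, which is again null and
  so is not charged by \<open>\<mu>\<close>.\<close>
lemma absolutely_continuous_loss_measure:
  fixes L :: "'a::euclidean_space \<Rightarrow> real"
  assumes L [measurable]: "L \<in> borel_measurable borel" and L_pos: "AE z in lborel. 0 < L z"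
  shows "absolutely_continuous lborel (loss_measure L \<mu>)"
  unfolding absolutely_continuous_def
proof
  fix A :: "real set" assume A: "A \<in> null_sets lborel"
  then have A_sets [measurable]: "A \<in> sets borel" by auto
  have "emeasure \<mu> {t. inverse (t * c) \<in> A} = 0" if c: "0 < c" for c
  proof -
    have "negligible (A - {0})"
      using A by (intro negligible_diff) (simp add: negligible_iff_null_sets null_sets_completionI)
    moreover have "(\<lambda>u. inverse (u * c)) differentiable_on (A - {0})"
      using c by (intro differentiable_on_inverse differentiable_on_mult differentiable_on_id differentiable_on_const) auto
    ultimately have "negligible ((\<lambda>u. inverse (u * c)) ` (A - {0}))"
      by (intro negligible_differentiable_image_negligible) auto
    then have "negligible (insert 0 ((\<lambda>u. inverse (u * c)) ` (A - {0})))"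
      by simp
    moreover have "{t. inverse (t * c) \<in> A} \<subseteq> insert 0 ((\<lambda>u. inverse (u * c)) ` (A - {0}))"
    proof
      fix t assume t: "t \<in> {t. inverse (t * c) \<in> A}"
      show "t \<in> insert 0 ((\<lambda>u. inverse (u * c)) ` (A - {0}))"
      proof (cases "t = 0")
        case False
        with c t show ?thesis
          by (intro insertI2 image_eqI[of _ _ "inverse (t * c)"]) (auto simp: field_simps)
      qed simp
    qed
    ultimately have "negligible {t. inverse (t * c) \<in> A}"
      by (rule negligible_subset)
    moreover have "{t. inverse (t * c) \<in> A} \<in> sets borel"
    proof -
      have "{t \<in> space borel. inverse (t * c) \<in> A} \<in> sets borel"
        by measurable
      then show ?thesis by simp
    qed
    ultimately have "{t. inverse (t * c) \<in> A} \<in> null_sets lborel"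
      by (simp add: negligible_iff_null_sets null_sets_completion_iff)
    with ac show ?thesis
      by (auto simp: absolutely_continuous_def)
  qed
  then have "(\<integral>\<^sup>+z. emeasure \<mu> {t. inverse (t * L z) \<in> A} \<partial>lborel) = (\<integral>\<^sup>+z. 0 \<partial>(lborel :: 'a measure))"
    using L_pos by (intro nn_integral_cong_AE) (auto elim!: eventually_mono)
  then show "A \<in> null_sets (loss_measure L \<mu>)"
    by (intro null_setsI) (simp_all add: emeasure_loss_measure)
qed

text \<open>For positive \<open>t\<close> and \<open>L z\<close>, the loss is at most \<open>\<beta>\<close> exactly when \<open>t \<ge> 1 / (L z \<beta>)\<close>; the resulting
  integral is that of the complementary distribution function.\<close>
lemma emeasure_loss_measure_atMost:
  fixes L :: "'a::euclidean_space \<Rightarrow> real"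
  assumes L [measurable]: "L \<in> borel_measurable borel" and L_pos: "AE z in lborel. 0 < L z"
  shows "0 < \<beta> \<Longrightarrow> emeasure (loss_measure L \<mu>) {..\<beta>} = (\<integral>\<^sup>+z. emeasure \<mu> {inverse (L z * \<beta>)..} \<partial>lborel)"
    and "\<beta> \<le> 0 \<Longrightarrow> emeasure (loss_measure L \<mu>) {..\<beta>} = 0"
proof -
  have meas: "{t. inverse (t * c) \<in> {..\<beta>}} \<in> sets \<mu>" for c
  proof -
    have "{t \<in> space borel. inverse (t * c) \<in> {..\<beta>}} \<in> sets borel"
      by measurable
    then show ?thesis by (simp add: sets_\<mu>)
  qed
  show "emeasure (loss_measure L \<mu>) {..\<beta>} = (\<integral>\<^sup>+z. emeasure \<mu> {inverse (L z * \<beta>)..} \<partial>lborel)" if "0 < \<beta>"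
    unfolding emeasure_loss_measure[OF L borel_closed[OF closed_atMost]]
  proof (rule nn_integral_cong_AE, use L_pos in eventually_elim)
    fix z assume Lz: "0 < L z"
    show "emeasure \<mu> {t. inverse (t * L z) \<in> {..\<beta>}} = emeasure \<mu> {inverse (L z * \<beta>)..}"
    proof (rule emeasure_eq_AE)
      show "AE t in \<mu>. t \<in> {t. inverse (t * L z) \<in> {..\<beta>}} \<longleftrightarrow> t \<in> {inverse (L z * \<beta>)..}"
        using pos by eventually_elim (use Lz \<open>0 < \<beta>\<close> in \<open>auto simp: field_simps\<close>)
    qed (use meas in \<open>auto simp: sets_\<mu>\<close>)
  qed
  show "emeasure (loss_measure L \<mu>) {..\<beta>} = 0" if "\<beta> \<le> 0"
  proof -
    have "emeasure (loss_measure L \<mu>) {..\<beta>} = (\<integral>\<^sup>+z. 0 \<partial>(lborel :: 'a measure))"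
      unfolding emeasure_loss_measure[OF L borel_closed[OF closed_atMost]]
    proof (rule nn_integral_cong_AE, use L_pos in eventually_elim)
      fix z assume Lz: "0 < L z"
      have "emeasure \<mu> {t. inverse (t * L z) \<in> {..\<beta>}} = emeasure \<mu> {}"
      proof (rule emeasure_eq_AE)
        show "AE t in \<mu>. t \<in> {t. inverse (t * L z) \<in> {..\<beta>}} \<longleftrightarrow> t \<in> {}"
          using pos
        proof eventually_elim
          case (elim t)
          then have "0 < inverse (t * L z)" using Lz by simp
          then show ?case using that by simp
        qed
      qed (use meas in auto)
      then show "emeasure \<mu> {t. inverse (t * L z) \<in> {..\<beta>}} = 0" by simp
    qed
    then show ?thesis by simp
  qed
qed

lemma emeasure_loss_measure_UNIV:
  assumes "L \<in> borel_measurable borel"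
  shows "emeasure (loss_measure L \<mu>) UNIV = \<infinity>"
  using emeasure_space_1 by (simp add: emeasure_loss_measure[OF assms] emeasure_lborel_UNIV)

end

text \<open>Independence sees only the sigma-algebra of the value space, so the plane may be regarded as carrying
  Lebesgue measure, its Borel sigma-algebra, or the intensity of a Poisson process.\<close>
lemma indep_rvs_cong_sets:
  assumes "sets T = sets T'"
  shows "indep_rvs M S X T Y \<longleftrightarrow> indep_rvs M S X T' Y"
  unfolding indep_rvs_def
  by (simp only: measurable_cong_sets[OF refl assms] sets_vimage_algebra_cong[OF assms])

theorem proposition1:
  fixes M :: "'w measure"
    and lamB :: real
    and L :: "real^2 \<Rightarrow> real"
    and H :: "'w \<Rightarrow> real"
    and pH :: "real \<Rightarrow> real"
    and y :: "nat \<Rightarrow> 'w \<Rightarrow> real^2"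
    and h :: "nat \<Rightarrow> real^2 \<Rightarrow> 'w \<Rightarrow> real"
  assumes prob: "prob_space M"
    and intensity_pos: "lamB > 0"
    and stations: "poisson_point_process_on M UNIV (density lborel (\<lambda>_. ennreal lamB)) y"
    and L_measurable: "L \<in> borel_measurable borel"
    and L_pos: "AE z in lborel. L z > 0"
    and H_nonneg: "AE \<omega> in M. H \<omega> \<ge> 0"
    and pH_nonneg: "\<And>t. pH t \<ge> 0"
    and H_density: "distributed M lborel H (\<lambda>t. ennreal (pH t))"
    and ccdf_pos: "\<And>\<beta>. ccdf M H \<beta> > 0"
    and h_measurable: "\<And>x i. h i x \<in> borel_measurable M"
    and h_copies: "\<And>x i. distr M borel (h i x) = distr M borel H"
    and h_indep: "\<And>x. prob_space.indep_vars M (\<lambda>_. borel) (\<lambda>i. h i x) UNIV"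
    and h_y_indep: "\<And>x. indep_rvs M
           (PiM UNIV (\<lambda>_. borel)) (\<lambda>\<omega> i. h i x \<omega>) (PiM UNIV (\<lambda>_. borel)) (\<lambda>\<omega> i. y i \<omega>)"
    and B_finite: "\<And>\<beta>. \<beta> > 0 \<Longrightarrow> integrable lborel (B_integrand M H L \<beta>)"
    and B_pos: "\<And>\<beta>. \<beta> > 0 \<Longrightarrow> B_fun M H L \<beta> > 0"
  shows "(\<forall>x. poisson_point_process_on M {0<..}
            (density lborel (\<lambda>t. ennreal (lamB * deriv (B_fun M H L) t)))
            (path_loss_fading L y h x))
         \<and> (B_fun M H L \<longlongrightarrow> 0) (at_right 0)
         \<and> filterlim (B_fun M H L) at_top at_top"
proof -
  interpret prob_space M by (rule prob)
  define \<mu> where "\<mu> = distr M borel H"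
  have H [measurable]: "H \<in> borel_measurable M"
    using distributed_measurable[OF H_density] by simp
  have \<mu>_density: "\<mu> = density lborel (\<lambda>t. ennreal (pH t))"
    using distributed_distr_eq_density[OF H_density] unfolding \<mu>_def
    by (metis distr_cong sets_lborel)
  have pH [measurable]: "(\<lambda>t. ennreal (pH t)) \<in> borel_measurable borel"
    using distributed_borel_measurable[OF H_density] by simp
  have \<mu>_ac: "absolutely_continuous lborel \<mu>"
    unfolding \<mu>_density by (rule absolutely_continuousI_density) simp
  interpret \<mu>: fading_law \<mu>
  proof (intro fading_law.intro fading_law_axioms.intro)
    show "prob_space \<mu>"
      unfolding \<mu>_def by (rule prob_space_distr) (rule H)
    show "sets \<mu> = sets borel" by (simp add: \<mu>_def)
    show "absolutely_continuous lborel \<mu>" by (rule \<mu>_ac)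
    have "AE t in \<mu>. 0 \<le> t"
      unfolding \<mu>_def using H_nonneg by (subst AE_distr_iff) auto
    moreover have "AE t in \<mu>. t \<noteq> 0"
      by (rule absolutely_continuous_AE[OF _ \<mu>_ac]) (simp_all add: \<mu>_def AE_lborel_singleton)
    ultimately show "AE t in \<mu>. 0 < t"
      by eventually_elim simp
  qed
  define \<nu> where "\<nu> = loss_measure L \<mu>"
  let ?B = "B_fun M H L"
  have ccdf_eq: "ccdf M H \<beta> = measure \<mu> {\<beta>..}" for \<beta>
    by (simp add: ccdf_def \<mu>_def measure_distr vimage_def Int_def conj_commute)
  have integrand_nonneg: "0 \<le> B_integrand M H L \<beta> z" for \<beta> z
    by (simp add: B_integrand_def ccdf_def)
  have B_nonneg: "0 \<le> ?B \<beta>" for \<beta>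
    unfolding B_fun_def by (rule integral_nonneg_AE) (simp add: integrand_nonneg)
  \<comment> \<open>For \<open>\<beta> \<le> 0\<close> the integrand is \<open>1\<close> almost everywhere; it is not integrable over the plane, and
    the integral takes its default value \<open>0\<close>.  So \<open>B\<close> is the distribution function of \<open>\<nu>\<close> on the
    whole line.\<close>
  have B_0: "?B \<beta> = 0" if "\<beta> \<le> 0" for \<beta>
  proof -
    have full: "ccdf M H t = 1" if "t \<le> 0" for t
    proof -
      have "AE s in \<mu>. s \<in> {t..}"
        using \<mu>.pos by eventually_elim (use that in simp)
      then show ?thesis
        unfolding ccdf_eq by (intro \<mu>.prob_eq_1[THEN iffD2]) (simp_all add: \<mu>.sets_\<mu>)
    qed
    have one: "AE z in lborel. B_integrand M H L \<beta> z = 1"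
      using L_pos
    proof eventually_elim
      case (elim z)
      then show ?case
        unfolding B_integrand_def using that by (intro full) (simp add: mult_nonneg_nonpos)
    qed
    show ?thesis
    proof (cases "integrable lborel (B_integrand M H L \<beta>)")
      case True
      then have "?B \<beta> = (\<integral>z. 1 \<partial>(lborel :: (real^2) measure))"
        unfolding B_fun_def using one by (intro integral_cong_AE) auto
      then show ?thesis
        by (simp add: measure_def emeasure_lborel_UNIV)
    qed (simp add: B_fun_def not_integrable_integral_eq)
  qed
  have \<nu>_B: "emeasure \<nu> {..\<beta>} = ennreal (?B \<beta>)" for \<beta>
  proof (cases "0 < \<beta>")
    case True
    have "emeasure \<nu> {..\<beta>} = (\<integral>\<^sup>+z. ennreal (B_integrand M H L \<beta> z) \<partial>lborel)"
      unfolding \<nu>_def \<mu>.emeasure_loss_measure_atMost(1)[OF L_measurable L_pos True]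
      by (simp add: B_integrand_def ccdf_eq \<mu>.emeasure_eq_measure)
    also have "\<dots> = ennreal (?B \<beta>)"
      unfolding B_fun_def using B_finite[OF True] integrand_nonneg by (intro nn_integral_eq_integral) auto
    finally show ?thesis .
  next
    case False
    then show ?thesis
      unfolding \<nu>_def by (simp add: \<mu>.emeasure_loss_measure_atMost(2)[OF L_measurable L_pos] B_0)
  qed
  have \<nu>_sets [measurable_cong]: "sets \<nu> = sets borel"
    by (simp add: \<nu>_def)
  have \<nu>_ac: "absolutely_continuous lborel \<nu>"
    unfolding \<nu>_def by (rule \<mu>.absolutely_continuous_loss_measure[OF L_measurable L_pos])
  note \<nu>_deriv = absolutely_continuous_eq_density_deriv[OF \<nu>_sets \<nu>_ac \<nu>_B B_nonneg]

  have "poisson_point_process_on M {0<..}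
      (density lborel (\<lambda>t. ennreal (lamB * deriv ?B t))) (path_loss_fading L y h x)" for x
  proof -
    let ?K = "density lborel (\<lambda>_::real^2. ennreal lamB)"
    let ?G = "\<lambda>(z, t). inverse (t * L (z - x))"
    have G: "?G \<in> measurable (?K \<Otimes>\<^sub>M borel) borel"
      using L_measurable by measurable
    have distr_eq: "distr (?K \<Otimes>\<^sub>M \<mu>) borel ?G = density lborel (\<lambda>t. ennreal (lamB * deriv ?B t))"
      unfolding \<nu>_deriv(2) \<nu>_def by (rule \<mu>.distr_loss_translate[OF L_measurable])
    have "emeasure (density \<nu> (\<lambda>_. ennreal lamB)) {..0} = 0"
      by (simp add: emeasure_density_const \<nu>_sets \<nu>_B B_0)
    moreover have "space borel - {0<..} = {..0::real}" by auto
    ultimately have null: "emeasure (distr (?K \<Otimes>\<^sub>M \<mu>) borel ?G) (space borel - {0<..}) = 0"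
      unfolding distr_eq \<nu>_deriv(2) by simp
    have "poisson_point_process_on M {0<..} (distr (?K \<Otimes>\<^sub>M \<mu>) borel ?G) (\<lambda>i \<omega>. ?G (y i \<omega>, h i x \<omega>))"
    proof (rule poisson_marking_mapping[where N=borel and h="\<lambda>i. h i x"])
      show "poisson_point_process_on M (space ?K) ?K y"
        using stations by simp
      show "indep_rvs M (PiM UNIV (\<lambda>_. borel)) (\<lambda>\<omega> i. h i x \<omega>) (PiM UNIV (\<lambda>_. ?K)) (\<lambda>\<omega> i. y i \<omega>)"
      proof (rule indep_rvs_cong_sets[THEN iffD1, OF _ h_y_indep])
        show "sets (PiM UNIV (\<lambda>_. borel)) = sets (PiM UNIV (\<lambda>_. ?K))"
          by (rule sets_PiM_cong) auto
      qed
    qed (use G h_indep h_copies null in \<open>auto simp: \<mu>_def\<close>)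
    moreover have "path_loss_fading L y h x = (\<lambda>i \<omega>. ?G (y i \<omega>, h i x \<omega>))"
      by (simp add: path_loss_fading_def fun_eq_iff)
    ultimately show ?thesis
      unfolding distr_eq by simp
  qed
  moreover have "(?B \<longlongrightarrow> 0) (at_right 0)"
  proof -
    have "isCont ?B 0"
      using \<nu>_deriv(1) by (simp add: continuous_on_eq_continuous_at)
    then have "(?B \<longlongrightarrow> ?B 0) (at 0)"
      by (simp add: isCont_def)
    then show ?thesis
      using B_0[of 0] by (simp add: filterlim_at_split)
  qed
  \<comment> \<open>The total mass of \<open>\<nu>\<close> is the Lebesgue measure of the plane, because \<open>\<mu>\<close> is a probability.\<close>
  moreover have "filterlim ?B at_top at_top"
  proof -
    have "(SUP n. emeasure \<nu> {..real n}) = emeasure \<nu> (\<Union>n. {..real n})"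
      by (rule SUP_emeasure_incseq) (auto simp: incseq_def)
    also have "(\<Union>n. {..real n}) = UNIV"
      using real_arch_simple by auto
    finally have SUP_B: "(SUP n. ennreal (?B (real n))) = \<infinity>"
      unfolding \<nu>_def using \<mu>.emeasure_loss_measure_UNIV[OF L_measurable] \<nu>_B[unfolded \<nu>_def] by simp
    show ?thesis
      unfolding filterlim_at_top
    proof
      fix Z :: real
      have "ennreal Z < (SUP n. ennreal (?B (real n)))"
        unfolding SUP_B by simp
      then obtain n where n: "ennreal Z < ennreal (?B (real n))"
        by (auto simp: less_SUP_iff)
      have "Z \<le> ?B t" if "real n \<le> t" for t
      proof -
        have "emeasure \<nu> {..real n} \<le> emeasure \<nu> {..t}"
          using that by (intro emeasure_mono) (auto simp: \<nu>_sets)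
        with n have "ennreal Z \<le> ennreal (?B t)"
          by (simp add: \<nu>_B)
        then show ?thesis
          using B_nonneg by (simp add: ennreal_le_iff)
      qed
      then show "eventually (\<lambda>t. Z \<le> ?B t) at_top"
        by (auto simp: eventually_at_top_linorder)
    qed
  qed
  ultimately show ?thesis by blast
qed

end
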